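(* For every cardinal $\tau\geq\mathfrak{c}$, there exists a precompact topological abelian group $H$ with the following properties: (a) $w(H)=\tau$; (b) $H=\bigcup_{n\in\omega} H_n$, where $H_0\subset H_1\subset H_2\subset\cdots$ are proper closed subgroups of $H$; (c) every quotient group of $H$ is either trivial or non-separable.
   Context: All topological groups are assumed to be Hausdorff. $\mathfrak{c}=2^{\omega}$, and $w(H)$ denotes the weight of $H$, i.e. the minimal cardinality of a base of the topology of $H$. A topological group is precompact if it is (topologically isomorphic to) a subgroup of a compact group; equivalently, for every neighborhood $U$ of the identity the group is covered by finitely many translates of $U$. A quotient group of a topological group $H$ means $H/N$ with the quotient topology, where $N$ is a closed normal subgroup of $H$ (the case $N=\{e\}$ is allowed). A group is trivial if it has exactly one element; a space is separable if it has a countable dense subset. *)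

theory Defs
  imports "HOL-Analysis.Analysis" "HOL-Algebra.Coset" "HOL-Algebra.Elementary_Groups"
begin

unbundle cardinal_syntax

(* All topological groups are Hausdorff by convention, so the axiom is built in. *)
definition topological_group :: "('a, 'm) monoid_scheme \<Rightarrow> 'a topology \<Rightarrow> bool" where
  "topological_group G X \<longleftrightarrow>
     group G \<and> topspace X = carrier G \<and> Hausdorff_space X \<and>
     continuous_map (prod_topology X X) X (\<lambda>(x, y). x \<otimes>\<^bsub>G\<^esub> y) \<and>
     continuous_map X X (\<lambda>x. inv\<^bsub>G\<^esub> x)"

(* The compact group K has to live in a fixed type. The type 'a set set loses nothing: one may
   replace K by the closure of the image of G, and a Hausdorff space with a dense subset D has at
   most 2^(2^|D|) points. *)
definition precompact_group :: "('a, 'm) monoid_scheme \<Rightarrow> 'a topology \<Rightarrow> bool" where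
  "precompact_group G X \<longleftrightarrow>
     topological_group G X \<and>
     (\<exists>(K :: 'a set set monoid) Y f.
        topological_group K Y \<and> compact_space Y \<and> f \<in> hom G K \<and> embedding_map X Y f)"

definition topology_base :: "'a topology \<Rightarrow> 'a set set \<Rightarrow> bool" where
  "topology_base X \<B> \<longleftrightarrow>
     (\<forall>V\<in>\<B>. openin X V) \<and>
     (\<forall>U x. openin X U \<and> x \<in> U \<longrightarrow> (\<exists>V\<in>\<B>. x \<in> V \<and> V \<subseteq> U))"

(* w(X) = \<kappa>: the cardinal \<kappa> is attained by a base and is a lower bound for all bases. *)
definition has_weight :: "'a topology \<Rightarrow> 'b rel \<Rightarrow> bool" where
  "has_weight X \<kappa> \<longleftrightarrow>
     (\<exists>\<B>. topology_base X \<B> \<and> card_of \<B> =o \<kappa>) \<and>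
     (\<forall>\<B>. topology_base X \<B> \<longrightarrow> \<kappa> \<le>o card_of \<B>)"

definition quotient_topology :: "'a topology \<Rightarrow> ('a \<Rightarrow> 'b) \<Rightarrow> 'b topology" where
  "quotient_topology X q =
     topology (\<lambda>U. U \<subseteq> q ` topspace X \<and> openin X {x \<in> topspace X. q x \<in> U})"

lemma openin_quotient_topology:
  "openin (quotient_topology X q) U \<longleftrightarrow>
     U \<subseteq> q ` topspace X \<and> openin X {x \<in> topspace X. q x \<in> U}"
proof -
  have "istopology (\<lambda>U. U \<subseteq> q ` topspace X \<and> openin X {x \<in> topspace X. q x \<in> U})"
    unfolding istopology_def
  proof (intro conjI allI impI)
    fix S T
    assume "S \<subseteq> q ` topspace X \<and> openin X {x \<in> topspace X. q x \<in> S}"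
      and "T \<subseteq> q ` topspace X \<and> openin X {x \<in> topspace X. q x \<in> T}"
    moreover have "{x \<in> topspace X. q x \<in> S \<inter> T} =
        {x \<in> topspace X. q x \<in> S} \<inter> {x \<in> topspace X. q x \<in> T}" by auto
    ultimately show "S \<inter> T \<subseteq> q ` topspace X" "openin X {x \<in> topspace X. q x \<in> S \<inter> T}"
      by auto
  next
    fix \<K>
    assume *: "\<forall>K\<in>\<K>. K \<subseteq> q ` topspace X \<and> openin X {x \<in> topspace X. q x \<in> K}"
    then show "\<Union>\<K> \<subseteq> q ` topspace X" by auto
    have "{x \<in> topspace X. q x \<in> \<Union>\<K>} = (\<Union>K\<in>\<K>. {x \<in> topspace X. q x \<in> K})" by auto
    with * show "openin X {x \<in> topspace X. q x \<in> \<Union>\<K>}" by auto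
  qed
  then show ?thesis
    unfolding quotient_topology_def by simp
qed

lemma topspace_quotient_topology: "topspace (quotient_topology X q) = q ` topspace X"
proof
  show "topspace (quotient_topology X q) \<subseteq> q ` topspace X"
    by (metis openin_quotient_topology openin_topspace)
  have "{x \<in> topspace X. q x \<in> q ` topspace X} = topspace X" by auto
  then have "openin (quotient_topology X q) (q ` topspace X)"
    by (simp add: openin_quotient_topology)
  then show "q ` topspace X \<subseteq> topspace (quotient_topology X q)"
    by (rule openin_subset)
qed

lemma quotient_map_quotient_topology: "quotient_map X (quotient_topology X q) q"
  by (auto simp: quotient_map_def topspace_quotient_topology openin_quotient_topology)

(* The topology of the quotient group G Mod N. *)
definition coset_topology :: "('a, 'm) monoid_scheme \<Rightarrow> 'a topology \<Rightarrow> 'a set \<Rightarrow> 'a set topology" where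
  "coset_topology G X N = quotient_topology X (\<lambda>x. N #>\<^bsub>G\<^esub> x)"

end

(*
  H is the direct sum of tau copies of the reals, with the topology defined by the characters cis o l,
  where l runs over the rational combinations of x |-> del u (x a); here del u are rational linear
  operators on the reals, indexed by the finite subsets u of an uncountable set B.

  Averaging a Fejer kernel over a proper closed subgroup N gives a character cis o l that is trivial on N
  but not on H. Given a countable subset D of H, all but countably many g in B satisfy
  del {g} (2 pi) = 0 and del {g} (l d) = 0 for d in D. Hence the character cis o del {g} o l is trivial on
  N and on D; it is nontrivial because del {g} has a partial right inverse. So the image of D is not
  dense in H/N.

  The weight is tau because a neighbourhood of 0 restricts only finitely many coordinates, and H is the
  union of the subgroups on which the coordinates c m with m >= n vanish, for distinct indices c m.
*)
theory Submission
  imports Defs "HOL-Library.Function_Algebras" "HOL-Algebra.Free_Abelian_Groups" "HOL-Real_Asymp.Real_Asymp"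
begin

section \<open>Embeddings into the torus\<close>

text \<open>Real-valued functionals with rational operators fit together because
  \<open>cis (l y) = 1\<close> means that \<open>l y\<close> is an integer multiple of 2 pi. An
  operator that kills 2 pi therefore turns \<open>cis o l\<close> into a character that is trivial
  wherever \<open>cis o l\<close> is. The obstacle is size: the functionals must admit composition
  with \<open>del {g}\<close> for all but countably many g, and yet there may be only \<tau> of
  them. Since \<open>del {g} o del u = del (insert g u)\<close> for g outside u, finite sets u
  suffice as indices. As B is a set of reals, there are at most continuum many such u, and this is
  where \<tau> \<ge> c enters. Every real number has a finite support in B and is killed by
  \<open>del {g}\<close> as soon as g lies outside it. A countable D involves only countably many
  supports, so an uncountable B always leaves a free g. The partial right inverse is
  \<open>ins g\<close>, which adds g to labels that lack it.\<close>

lemma continuous_map_into_pullback: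
  assumes "continuous_map X Y g" "\<And>x. x \<in> topspace X \<Longrightarrow> g x = f (h x)" "h \<in> topspace X \<rightarrow> B"
  shows "continuous_map X (pullback_topology B f Y) h"
proof (rule continuous_map_pullback')
  show "continuous_map X Y (f \<circ> h)"
    using assms by (metis (no_types, lifting) comp_apply continuous_map_eq)
  show "topspace X \<subseteq> h -` B" using assms(3) by auto
qed

lemma topspace_pullback:
  assumes "f \<in> A \<rightarrow> topspace Y"
  shows "topspace (pullback_topology A f Y) = A"
  using assms by (auto simp: topspace_pullback_topology)

lemma continuous_map_of_pullback:
  assumes "continuous_map Y Z g"
  shows "continuous_map (pullback_topology A f Y) Z (\<lambda>x. g (f x))"
  using continuous_map_pullback[OF assms] by (simp add: o_def)

text \<open>Composed with \<open>f\<close>, the operations of \<open>G\<close> become those of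
  \<open>K\<close>, which gives continuity; injectivity of \<open>f\<close> pulls back the Hausdorff
  property.\<close>

lemma topological_group_pullback:
  assumes G: "group G" and K: "topological_group K Y" and f: "f \<in> hom G K"
    and inj: "inj_on f (carrier G)"
  shows "topological_group G (pullback_topology (carrier G) f Y)" (is "topological_group G ?X")
proof -
  have Kg: "group K" and KY: "topspace Y = carrier K" and KH: "Hausdorff_space Y"
    and Km: "continuous_map (prod_topology Y Y) Y (\<lambda>(x, y). x \<otimes>\<^bsub>K\<^esub> y)"
    and Ki: "continuous_map Y Y (\<lambda>x. inv\<^bsub>K\<^esub> x)"
    using K by (auto simp: topological_group_def)
  interpret group_hom G K f
    using G Kg f by (simp add: group_hom_def group_hom_axioms_def)
  have top: "topspace ?X = carrier G"
    using f KY by (intro topspace_pullback) (auto simp: hom_def)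
  have fc: "continuous_map ?X Y f"
    using continuous_map_of_pullback[OF continuous_map_id[of Y]] by simp
  have "Hausdorff_space ?X"
    using Hausdorff_space_injective_preimage[OF KH fc] inj top by simp
  moreover have "continuous_map (prod_topology ?X ?X) ?X (\<lambda>(x, y). x \<otimes>\<^bsub>G\<^esub> y)"
  proof (rule continuous_map_into_pullback)
    have "continuous_map (prod_topology ?X ?X) Y (\<lambda>z. (\<lambda>(x, y). x \<otimes>\<^bsub>K\<^esub> y) (f (fst z), f (snd z)))"
      by (intro continuous_map_compose[OF _ Km, unfolded o_def] continuous_map_pairedI
          continuous_map_compose[OF continuous_map_fst fc, unfolded o_def]
          continuous_map_compose[OF continuous_map_snd fc, unfolded o_def])
    then show "continuous_map (prod_topology ?X ?X) Y (\<lambda>z. f (fst z) \<otimes>\<^bsub>K\<^esub> f (snd z))"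
      by simp
  qed (auto simp: top)
  moreover have "continuous_map ?X ?X (\<lambda>x. inv\<^bsub>G\<^esub> x)"
  proof (rule continuous_map_into_pullback)
    show "continuous_map ?X Y (\<lambda>z. inv\<^bsub>K\<^esub> (f z))"
      using continuous_map_compose[OF fc Ki] by (simp add: o_def)
  qed (auto simp: top)
  ultimately show ?thesis
    using G top by (simp add: topological_group_def)
qed

lemma embedding_map_pullback:
  assumes "f \<in> A \<rightarrow> topspace Y" "inj_on f A"
  shows "embedding_map (pullback_topology A f Y) Y f"
proof -
  let ?X = "pullback_topology A f Y"
  have top: "topspace ?X = A" using assms(1) by (rule topspace_pullback)
  have fc: "continuous_map ?X Y f"
    using continuous_map_of_pullback[OF continuous_map_id[of Y]] by simp
  have "openin (subtopology Y (f ` A)) (f ` S)" if "openin ?X S" for S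
  proof -
    obtain U where "openin Y U" "S = f -` U \<inter> A"
      using \<open>openin ?X S\<close> unfolding openin_pullback_topology by blast
    then show ?thesis
      by (auto simp: openin_subtopology intro!: exI[of _ U])
  qed
  then have "open_map ?X (subtopology Y (f ` A)) f"
    by (simp add: open_map_def)
  then show ?thesis
    unfolding embedding_map_def top
    using fc assms top
    by (intro bijective_open_imp_homeomorphic_map)
      (auto simp: continuous_map_in_subtopology)
qed

definition transported_group :: "('a \<Rightarrow> 'b) \<Rightarrow> 'a monoid \<Rightarrow> 'b monoid" where
  "transported_group j K = \<lparr>carrier = j ` carrier K,
     monoid.mult = (\<lambda>x y. j (inv_into (carrier K) j x \<otimes>\<^bsub>K\<^esub> inv_into (carrier K) j y)),
     one = j \<one>\<^bsub>K\<^esub>\<rparr>"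

lemma transported_group:
  assumes K: "group K" and j: "inj_on j (carrier K)"
  shows "group (transported_group j K)"
    and "inv_into (carrier K) j \<in> hom (transported_group j K) K"
    and "j \<in> hom K (transported_group j K)"
proof -
  interpret group K by (rule K)
  have [simp]: "inv_into (carrier K) j (j x) = x" if "x \<in> carrier K" for x
    using that j by (rule inv_into_f_f[rotated])
  show "group (transported_group j K)"
  proof (rule groupI)
    fix x assume "x \<in> carrier (transported_group j K)"
    then obtain y where "y \<in> carrier K" "x = j y" by (auto simp: transported_group_def)
    then show "\<exists>y\<in>carrier (transported_group j K). y \<otimes>\<^bsub>transported_group j K\<^esub> x = \<one>\<^bsub>transported_group j K\<^esub>"
      by (intro bexI[of _ "j (inv\<^bsub>K\<^esub> y)"]) (auto simp: transported_group_def)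
  qed (auto simp: transported_group_def m_assoc)
  show "inv_into (carrier K) j \<in> hom (transported_group j K) K" "j \<in> hom K (transported_group j K)"
    by (auto simp: hom_def transported_group_def)
qed

text \<open>\<open>precompact_group\<close> asks for a compact group with elements in
  \<open>'a set set\<close>, whereas here \<open>K\<close> has elements of the same type as
  \<open>G\<close>. The injection x |-> {{x}} provides a homeomorphic copy.\<close>

lemma precompact_groupI:
  fixes G :: "'a monoid" and K :: "'a monoid"
  assumes X: "topological_group G X" and K: "topological_group K Y" and Y: "compact_space Y"
    and f: "f \<in> hom G K" "embedding_map X Y f"
  shows "precompact_group G X"
proof -
  define j :: "'a \<Rightarrow> 'a set set" where "j = (\<lambda>x. {{x}})"
  define K' where "K' = transported_group j K"
  define i where "i = inv_into (carrier K) j"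
  define Y' where "Y' = pullback_topology (carrier K') i Y"
  have inj: "inj_on j (carrier K)" by (auto simp: j_def inj_on_def)
  have Kg: "group K" and KY: "topspace Y = carrier K" using K by (auto simp: topological_group_def)
  note tr = transported_group[OF Kg inj, folded K'_def i_def]
  have cK': "carrier K' = j ` carrier K" by (simp add: K'_def transported_group_def)
  have ij: "i (j x) = x" if "x \<in> carrier K" for x
    unfolding i_def using inj that by (rule inv_into_f_f)
  have iinj: "inj_on i (carrier K')" by (auto simp: cK' inj_on_def ij)
  have "topological_group K' Y'"
    unfolding Y'_def using tr K iinj by (intro topological_group_pullback)
  have topY': "topspace Y' = carrier K'"
    unfolding Y'_def using KY ij by (intro topspace_pullback) (auto simp: cK')
  have icont: "continuous_map Y' Y i"
    unfolding Y'_def using continuous_map_of_pullback[OF continuous_map_id[of Y]] by simp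
  have jcont: "continuous_map Y Y' j"
    unfolding Y'_def
    by (rule continuous_map_into_pullback[OF continuous_map_id]) (auto simp: ij KY cK')
  have hom: "homeomorphic_map Y Y' j"
    unfolding homeomorphic_map_maps homeomorphic_maps_def
    using icont jcont by (intro exI[of _ i]) (auto simp: KY topY' ij cK')
  then have "compact_space Y'"
    using Y homeomorphic_compact_space homeomorphic_map_imp_homeomorphic_space by blast
  moreover have "embedding_map X Y' (j \<circ> f)"
    using f(2) hom embedding_map_compose homeomorphic_map_def injective_open_imp_embedding_map
      homeomorphic_imp_open_map homeomorphic_imp_continuous_map homeomorphic_imp_injective_map by metis
  moreover have "j \<circ> f \<in> hom G K'"
    using f(1) tr(3) by (rule Group.hom_compose)
  ultimately show ?thesis
    using X \<open>topological_group K' Y'\<close> by (auto simp: precompact_group_def)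
qed

section \<open>Powers of the circle as compact groups\<close>

lemma continuous_map_mult_algebra:
  fixes f g :: "'a \<Rightarrow> 'b::real_normed_algebra"
  assumes "continuous_map X euclidean f" "continuous_map X euclidean g"
  shows "continuous_map X euclidean (\<lambda>x. f x * g x)"
  using assms by (simp add: continuous_map_atin tendsto_mult)

definition torus_group :: "'i set \<Rightarrow> ('i \<Rightarrow> complex) monoid" where
  "torus_group I = \<lparr>carrier = I \<rightarrow>\<^sub>E sphere 0 1, monoid.mult = (\<lambda>x y. \<lambda>i\<in>I. x i * y i), one = (\<lambda>i\<in>I. 1)\<rparr>"

definition torus_topology :: "'i set \<Rightarrow> ('i \<Rightarrow> complex) topology" where
  "torus_topology I = product_topology (\<lambda>_. top_of_set (sphere 0 1)) I"

lemma group_torus: "group (torus_group I)"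
proof (rule groupI)
  fix x assume x: "x \<in> carrier (torus_group I)"
  have "cnj (x i) * x i = 1" if "i \<in> I" for i
  proof -
    have "norm (x i) = 1" using x that by (auto simp: torus_group_def)
    then show ?thesis by (simp add: mult.commute complex_norm_square[symmetric])
  qed
  then show "\<exists>y\<in>carrier (torus_group I). y \<otimes>\<^bsub>torus_group I\<^esub> x = \<one>\<^bsub>torus_group I\<^esub>"
    using x
    by (intro bexI[of _ "\<lambda>i\<in>I. cnj (x i)"]) (auto simp: torus_group_def PiE_iff fun_eq_iff)
qed (auto simp: torus_group_def PiE_iff norm_mult fun_eq_iff mult.assoc extensional_def restrict_def)

lemma inv_torus_group:
  assumes "x \<in> carrier (torus_group I)"
  shows "inv\<^bsub>torus_group I\<^esub> x = (\<lambda>i\<in>I. cnj (x i))"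
proof (rule group.inv_equality[OF group_torus])
  have "cnj (x i) * x i = 1" if "i \<in> I" for i
  proof -
    have "norm (x i) = 1" using assms that by (auto simp: torus_group_def)
    then show ?thesis by (simp add: mult.commute complex_norm_square[symmetric])
  qed
  then show "(\<lambda>i\<in>I. cnj (x i)) \<otimes>\<^bsub>torus_group I\<^esub> x = \<one>\<^bsub>torus_group I\<^esub>"
    by (auto simp: torus_group_def)
qed (use assms in \<open>auto simp: torus_group_def PiE_iff\<close>)

lemma topological_group_torus: "topological_group (torus_group I) (torus_topology I)"
proof -
  let ?Y = "torus_topology I"
  have top: "topspace ?Y = carrier (torus_group I)"
    by (simp add: torus_topology_def torus_group_def)
  have proj: "continuous_map ?Y euclidean (\<lambda>x. x i)" if "i \<in> I" for i
    unfolding torus_topology_def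
    using continuous_map_product_projection[OF that, of "\<lambda>_. top_of_set (sphere (0::complex) 1)"]
    by (simp add: continuous_map_in_subtopology)
  have "continuous_map (prod_topology ?Y ?Y) ?Y (\<lambda>z. \<lambda>i\<in>I. fst z i * snd z i)"
    (is "continuous_map ?P _ _")
  proof -
    have "continuous_map ?P euclidean (\<lambda>z. fst z i * snd z i)" if "i \<in> I" for i
      by (intro continuous_map_mult_algebra
          continuous_map_compose[OF continuous_map_fst proj[OF that], unfolded o_def]
          continuous_map_compose[OF continuous_map_snd proj[OF that], unfolded o_def])
    then show ?thesis
      apply (subst (3) torus_topology_def)
      by (auto simp: continuous_map_componentwise continuous_map_in_subtopology top
          torus_group_def PiE_iff norm_mult)
  qed
  then have "continuous_map (prod_topology ?Y ?Y) ?Y (\<lambda>(x, y). x \<otimes>\<^bsub>torus_group I\<^esub> y)"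
    by (simp add: torus_group_def case_prod_unfold)
  moreover have "continuous_map ?Y ?Y (\<lambda>x. \<lambda>i\<in>I. cnj (x i))"
  proof -
    have "continuous_map ?Y euclidean (\<lambda>z. cnj (z i))" if "i \<in> I" for i
      by (rule continuous_map_compose[OF proj[OF that], unfolded o_def])
        (auto intro: continuous_intros)
    then show ?thesis
      apply (subst (2) torus_topology_def)
      by (auto simp: continuous_map_componentwise continuous_map_in_subtopology top
          torus_group_def PiE_iff)
  qed
  then have "continuous_map ?Y ?Y (\<lambda>x. inv\<^bsub>torus_group I\<^esub> x)"
    by (rule continuous_map_eq) (simp add: top inv_torus_group)
  moreover have "Hausdorff_space ?Y"
    unfolding torus_topology_def
    by (auto simp: Hausdorff_space_product_topology Hausdorff_space_subtopology)
  ultimately show ?thesis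
    by (simp add: topological_group_def group_torus top)
qed

lemma compact_space_torus: "compact_space (torus_topology I)"
  by (auto simp: torus_topology_def compact_space_product_topology compact_space_subtopology)

section \<open>Means of trigonometric polynomials\<close>

text \<open>For w \<noteq> 1 the geometric sums stay bounded by 2 / |1 - w|, so division by n sends
  them to 0.\<close>

lemma geometric_mean_tendsto:
  fixes w :: complex
  assumes "norm w = 1"
  shows "(\<lambda>n. (\<Sum>m<n. w ^ m) / of_nat n) \<longlonglongrightarrow> (if w = 1 then 1 else 0)"
proof (cases "w = 1")
  case True
  have "(\<lambda>n. of_nat n / of_nat n :: complex) \<longlonglongrightarrow> 1"
    by (rule tendsto_eventually) (auto intro: eventually_sequentiallyI[of 1])
  with True show ?thesis by simp
next
  case False
  have "(\<lambda>n. (\<Sum>m<n. w ^ m) / of_nat n) \<longlonglongrightarrow> 0"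
  proof (rule Lim_null_comparison[where g = "\<lambda>n. (2 / norm (1 - w)) * (1 / real n)"])
    have "norm (\<Sum>m<n. w ^ m) \<le> 2 / norm (1 - w)" for n
    proof -
      have "(\<Sum>m<n. w ^ m) = (1 - w ^ n) / (1 - w)"
        using False by (simp add: sum_gp_strict)
      then have "norm (\<Sum>m<n. w ^ m) = norm (1 - w ^ n) / norm (1 - w)"
        by (simp add: norm_divide)
      also have "\<dots> \<le> 2 / norm (1 - w)"
        using norm_triangle_ineq4[of 1 "w ^ n"] assms
        by (intro divide_right_mono) (auto simp: norm_power)
      finally show ?thesis .
    qed
    then show "\<forall>\<^sub>F n in sequentially. norm ((\<Sum>m<n. w ^ m) / of_nat n) \<le> (2 / norm (1 - w)) * (1 / real n)"
      by (intro always_eventually allI) (metis (no_types, lifting) divide_right_mono mult.right_neutral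
          norm_divide norm_of_nat of_nat_0_le_iff times_divide_eq_right)
    show "(\<lambda>n. (2 / norm (1 - w)) * (1 / real n)) \<longlonglongrightarrow> 0"
      by (rule tendsto_mult_right_zero) (rule lim_1_over_n)
  qed
  with False show ?thesis by simp
qed

text \<open>Averaging over the multiples of \<open>y\<close> removes the characters that are nontrivial at \<open>y\<close>.\<close>

lemma norm_trig_sum_trivial_at_le:
  fixes c :: "'i \<Rightarrow> 'v::ab_group_add \<Rightarrow> complex"
  assumes F: "finite F" and N: "\<And>x y. x \<in> N \<Longrightarrow> y \<in> N \<Longrightarrow> x + y \<in> N"
    and mult: "\<And>i x y. i \<in> F \<Longrightarrow> c i (x + y) = c i x * c i y"
    and norm: "\<And>i x. i \<in> F \<Longrightarrow> norm (c i x) = 1"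
    and le: "\<And>x. x \<in> N \<Longrightarrow> norm (\<Sum>i\<in>F. a i * c i x) \<le> \<epsilon>"
    and y: "y \<in> N" and x: "x \<in> N"
  shows "norm (\<Sum>i | i \<in> F \<and> c i y = 1. a i * c i x) \<le> \<epsilon>"
proof -
  \<comment> \<open>This is x + m * y, written by iteration because the group carries no scalar
    multiplication.\<close>
  define z where "z m = ((+) y ^^ m) x" for m
  have zN: "z m \<in> N" for m
    by (induction m) (auto simp: z_def x y N)
  have cz: "c i (z m) = c i y ^ m * c i x" if "i \<in> F" for i m
    by (induction m) (auto simp: z_def mult[OF that])
  let ?avg = "\<lambda>n. (\<Sum>m<n. \<Sum>i\<in>F. a i * c i (z m)) / of_nat n"
  have avg: "?avg n = (\<Sum>i\<in>F. a i * c i x * ((\<Sum>m<n. c i y ^ m) / of_nat n))" for n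
  proof -
    have "(\<Sum>m<n. \<Sum>i\<in>F. a i * c i (z m)) = (\<Sum>i\<in>F. \<Sum>m<n. a i * c i (z m))"
      by (rule sum.swap)
    also have "\<dots> = (\<Sum>i\<in>F. a i * c i x * (\<Sum>m<n. c i y ^ m))"
      by (intro sum.cong refl) (simp add: cz sum_distrib_left mult_ac)
    finally show ?thesis unfolding sum_divide_distrib by (simp flip: sum_divide_distrib)
  qed
  have "?avg \<longlonglongrightarrow> (\<Sum>i\<in>F. a i * c i x * (if c i y = 1 then 1 else 0))"
    unfolding avg by (intro tendsto_intros geometric_mean_tendsto norm)
  also have "(\<Sum>i\<in>F. a i * c i x * (if c i y = 1 then 1 else 0)) = (\<Sum>i | i \<in> F \<and> c i y = 1. a i * c i x)"
    using F by (simp add: if_distrib[of "(*) _"] sum.inter_filter cong: if_cong)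
  finally have lim: "?avg \<longlonglongrightarrow> (\<Sum>i | i \<in> F \<and> c i y = 1. a i * c i x)" .
  have "norm (?avg n) \<le> \<epsilon>" if "n > 0" for n
  proof -
    have "norm (\<Sum>m<n. \<Sum>i\<in>F. a i * c i (z m)) \<le> of_nat (card {..<n}) * \<epsilon>"
      by (rule sum_norm_bound) (rule le[OF zN])
    with that show ?thesis by (simp add: norm_divide field_simps)
  qed
  then have "\<forall>\<^sub>F n in sequentially. norm (?avg n) \<le> \<epsilon>"
    by (intro eventually_sequentiallyI[of 1]) auto
  with tendsto_norm[OF lim] show ?thesis
    by (rule tendsto_upperbound) simp
qed

text \<open>A substitute for an invariant mean on \<open>N\<close>. As long as some character is
  nontrivial at some \<open>y\<close> in \<open>N\<close>, averaging along \<open>y\<close> deletes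
  it, keeps all characters trivial on \<open>N\<close> and preserves the bound. When only the latter
  are left, evaluation at 0 gives the sum of their coefficients.\<close>

lemma norm_sum_trivial_characters_le:
  fixes c :: "'i \<Rightarrow> 'v::ab_group_add \<Rightarrow> complex"
  assumes F: "finite F" and N: "\<And>x y. x \<in> N \<Longrightarrow> y \<in> N \<Longrightarrow> x + y \<in> N" and zero: "0 \<in> N"
    and mult: "\<And>i x y. i \<in> F \<Longrightarrow> c i (x + y) = c i x * c i y"
    and norm: "\<And>i x. i \<in> F \<Longrightarrow> norm (c i x) = 1"
    and le: "\<And>x. x \<in> N \<Longrightarrow> norm (\<Sum>i\<in>F. a i * c i x) \<le> \<epsilon>"
  shows "norm (\<Sum>i | i \<in> F \<and> (\<forall>y\<in>N. c i y = 1). a i) \<le> \<epsilon>"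
  using F mult norm le
proof (induction F rule: finite_psubset_induct)
  case (psubset F)
  show ?case
  proof (cases "\<forall>i\<in>F. \<forall>y\<in>N. c i y = 1")
    case True
    then have "{i \<in> F. \<forall>y\<in>N. c i y = 1} = F" by auto
    moreover have "(\<Sum>i\<in>F. a i * c i 0) = (\<Sum>i\<in>F. a i)"
      using True zero by (intro sum.cong) auto
    ultimately show ?thesis using psubset.prems(3)[OF zero] by simp
  next
    case False
    then obtain j y where j: "j \<in> F" "y \<in> N" "c j y \<noteq> 1" by blast
    let ?F = "{i \<in> F. c i y = 1}"
    have "norm (\<Sum>i | i \<in> ?F \<and> (\<forall>y\<in>N. c i y = 1). a i) \<le> \<epsilon>"
    proof (rule psubset.IH)
      show "?F \<subset> F" using j by auto
      show "norm (\<Sum>i\<in>?F. a i * c i x) \<le> \<epsilon>" if "x \<in> N" for x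
        using psubset.hyps N psubset.prems \<open>y \<in> N\<close> that by (rule norm_trig_sum_trivial_at_le)
    qed (use psubset.prems in auto)
    moreover have "{i \<in> ?F. \<forall>y\<in>N. c i y = 1} = {i \<in> F. \<forall>y\<in>N. c i y = 1}"
      using j by auto
    ultimately show ?thesis by simp
  qed
qed

text \<open>On the unit circle \<open>cnj w\<close> is the inverse of \<open>w\<close>, so |1 + w|^2
  = (1 + w)^2 * cnj w and the binomial theorem applies. The term for k stands for the power k - M;
  the constant term is k = M.\<close>

lemma fejer_expansion:
  fixes w :: complex
  assumes "norm w = 1"
  shows "of_real ((norm (1 + w)) ^ (2 * M)) = (\<Sum>k\<le>2*M. of_nat ((2*M) choose k) * (w ^ k * cnj w ^ M))"
proof -
  have w: "w * cnj w = 1"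
    using assms by (simp add: complex_norm_square[symmetric])
  have "(1 + w) * cnj w = cnj (1 + w)" using w by (simp add: algebra_simps)
  have "of_real ((norm (1 + w)) ^ (2 * M)) = ((1 + w) * cnj (1 + w)) ^ M"
    by (simp only: complex_norm_square[symmetric] power_mult of_real_power)
  also have "\<dots> = (1 + w) ^ (2 * M) * cnj w ^ M"
    unfolding \<open>(1 + w) * cnj w = cnj (1 + w)\<close>[symmetric]
    by (simp add: power_mult_distrib power_mult power2_eq_square mult_ac)
  also have "(1 + w) ^ (2 * M) = (\<Sum>k\<le>2*M. of_nat ((2*M) choose k) * w ^ k)"
    using binomial_ring[of w 1 "2 * M"] by (simp add: add.commute)
  finally show ?thesis by (simp only: sum_distrib_right mult.assoc)
qed

text \<open>Parallelogram law for 1 and \<open>w\<close>.\<close>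

lemma norm_one_plus_square:
  fixes w :: complex
  assumes "norm w = 1"
  shows "(norm (1 + w))\<^sup>2 = 4 - (norm (1 - w))\<^sup>2"
proof -
  have "(norm (1 + w))\<^sup>2 + (norm (1 - w))\<^sup>2 = 2 * (1 + (norm w)\<^sup>2)"
    unfolding cmod_power2 by (simp add: power2_eq_square algebra_simps)
  with assms show ?thesis by simp
qed

text \<open>
  Here \<open>P y = (\<Prod>j\<in>J. \<bar>(1 + \<xi> j (y - x0)) / 2\<bar> ^ (2 * M))\<close> is a trigonometric polynomial which decays
  exponentially in \<open>M\<close> on \<open>N\<close>. If all characters that are trivial on \<open>N\<close> were trivial at \<open>x0\<close>, then
  its mean over \<open>N\<close> would be at least the constant coefficient, a power of \<open>1 / M\<close>.
\<close>

lemma separating_character: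
  fixes \<xi> :: "'j \<Rightarrow> 'v::ab_group_add \<Rightarrow> complex"
  assumes J: "finite J" and N: "\<And>x y. x \<in> N \<Longrightarrow> y \<in> N \<Longrightarrow> x + y \<in> N" and zero: "0 \<in> N"
    and mult: "\<And>j x y. j \<in> J \<Longrightarrow> \<xi> j (x + y) = \<xi> j x * \<xi> j y"
    and norm: "\<And>j x. j \<in> J \<Longrightarrow> norm (\<xi> j x) = 1"
    and \<delta>: "\<delta> > 0" and far: "\<And>y. y \<in> N \<Longrightarrow> \<exists>j\<in>J. \<delta> \<le> norm (\<xi> j y - \<xi> j x0)"
  shows "\<exists>\<kappa> M. (\<forall>y\<in>N. (\<Prod>j\<in>J. \<xi> j y ^ \<kappa> j * cnj (\<xi> j y) ^ M) = 1) \<and>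
               (\<Prod>j\<in>J. \<xi> j x0 ^ \<kappa> j * cnj (\<xi> j x0) ^ M) \<noteq> 1"
proof (rule ccontr)
  define c where "c M \<kappa> y = (\<Prod>j\<in>J. \<xi> j y ^ \<kappa> j * cnj (\<xi> j y) ^ M)" for M \<kappa> y
  assume "\<not> ?thesis"
  then have triv: "c M \<kappa> x0 = 1" if "\<forall>y\<in>N. c M \<kappa> y = 1" for M \<kappa>
    using that by (auto simp: c_def)
  \<comment> \<open>Where |1 - w| \<ge> \<delta>, the factor (|1 + w| / 2)^2 is at most 1 -
    \<delta>^2 / 4. The maximum with 1/2 keeps the base positive.\<close>
  define \<rho> where "\<rho> = max (1/2) (1 - \<delta>\<^sup>2 / 4)"
  have \<rho>: "0 < \<rho>" "\<rho> < 1" using \<delta> by (auto simp: \<rho>_def)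
  define b where "b M k = real ((2*M) choose k) / 4 ^ M" for M k
  have bound: "(1 / (2 * real M)) ^ card J \<le> \<rho> ^ M" if M: "M > 0" for M
  proof -
    define F where "F = (J \<rightarrow>\<^sub>E {..2*M})"
    \<comment> \<open>The last factor is what centring the polynomial at \<open>x0\<close>
      contributes to the coefficient of \<open>c M \<kappa>\<close>.\<close>
    define a where "a \<kappa> = (\<Prod>j\<in>J. of_real (b M (\<kappa> j))) * cnj (c M \<kappa> x0)" for \<kappa>
    have finF: "finite F" unfolding F_def using J by (intro finite_PiE) auto
    have cnorm: "norm (c M \<kappa> y) = 1" for \<kappa> y
      by (auto simp: c_def prod_norm[symmetric] norm_mult norm_power norm intro!: prod.neutral)
    have cmult: "c M \<kappa> (x + y) = c M \<kappa> x * c M \<kappa> y" for \<kappa> x y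
      by (auto simp: c_def prod.distrib[symmetric] mult power_mult_distrib mult_ac intro!: prod.cong)
    have P: "(\<Sum>\<kappa>\<in>F. a \<kappa> * c M \<kappa> y)
        = of_real (\<Prod>j\<in>J. (norm (1 + \<xi> j y * cnj (\<xi> j x0))) ^ (2 * M) / 4 ^ M)" for y
    proof -
      have "of_real (\<Prod>j\<in>J. (norm (1 + \<xi> j y * cnj (\<xi> j x0))) ^ (2 * M) / 4 ^ M)
          = (\<Prod>j\<in>J. \<Sum>k\<le>2*M. of_real (b M k) *
              ((\<xi> j y * cnj (\<xi> j x0)) ^ k * cnj (\<xi> j y * cnj (\<xi> j x0)) ^ M))"
      proof (unfold of_real_prod, intro prod.cong refl)
        fix j assume "j \<in> J"
        then have "norm (\<xi> j y * cnj (\<xi> j x0)) = 1" by (simp add: norm_mult norm)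
        from fejer_expansion[OF this, of M]
        show "of_real ((norm (1 + \<xi> j y * cnj (\<xi> j x0))) ^ (2 * M) / 4 ^ M) =
           (\<Sum>k\<le>2*M. of_real (b M k) *
              ((\<xi> j y * cnj (\<xi> j x0)) ^ k * cnj (\<xi> j y * cnj (\<xi> j x0)) ^ M))"
          by (simp only: of_real_divide b_def) (simp add: sum_divide_distrib)
      qed
      also have "\<dots> = (\<Sum>\<kappa>\<in>F. \<Prod>j\<in>J. of_real (b M (\<kappa> j)) *
              ((\<xi> j y * cnj (\<xi> j x0)) ^ \<kappa> j * cnj (\<xi> j y * cnj (\<xi> j x0)) ^ M))"
        unfolding F_def by (rule prod_sum_PiE) (use J in auto)
      also have "\<dots> = (\<Sum>\<kappa>\<in>F. a \<kappa> * c M \<kappa> y)"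
        by (intro sum.cong refl)
          (simp add: a_def c_def prod.distrib power_mult_distrib mult_ac)
      finally show ?thesis by simp
    qed
    have le: "norm (\<Sum>\<kappa>\<in>F. a \<kappa> * c M \<kappa> y) \<le> \<rho> ^ M" if y: "y \<in> N" for y
    proof -
      let ?q = "\<lambda>j. (norm (1 + \<xi> j y * cnj (\<xi> j x0))) ^ (2 * M) / 4 ^ M"
      obtain i where i: "i \<in> J" "\<delta> \<le> norm (\<xi> i y - \<xi> i x0)" using far[OF y] by blast
      have q: "?q j = (1 - (norm (\<xi> j y - \<xi> j x0))\<^sup>2 / 4) ^ M" if "j \<in> J" for j
      proof -
        let ?w = "\<xi> j y * cnj (\<xi> j x0)"
        have "norm ?w = 1" using that by (simp add: norm_mult norm)
        have "\<xi> j x0 * cnj (\<xi> j x0) = 1"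
          using norm[OF that] by (simp add: complex_norm_square[symmetric])
        then have "1 - ?w = (\<xi> j x0 - \<xi> j y) * cnj (\<xi> j x0)" by (simp add: algebra_simps)
        then have "norm (1 - ?w) = norm (\<xi> j y - \<xi> j x0)"
          using norm[OF that] by (simp add: norm_mult norm_minus_commute)
        with norm_one_plus_square[OF \<open>norm ?w = 1\<close>]
        show ?thesis by (simp add: power_mult power_divide[symmetric] diff_divide_distrib)
      qed
      have q0: "0 \<le> ?q j" "?q j \<le> 1" if "j \<in> J" for j
      proof -
        show "0 \<le> ?q j" by simp
        have "norm (\<xi> j y - \<xi> j x0) \<le> 2"
          using norm_triangle_ineq4[of "\<xi> j y" "\<xi> j x0"] norm[OF that] by simp
        then have "(norm (\<xi> j y - \<xi> j x0))\<^sup>2 \<le> 2\<^sup>2" by (intro power_mono) auto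
        then show "?q j \<le> 1" unfolding q[OF that] by (intro power_le_one) auto
      qed
      have "?q i \<le> \<rho> ^ M"
      proof -
        have "norm (\<xi> i y - \<xi> i x0) \<le> 2"
          using norm_triangle_ineq4[of "\<xi> i y" "\<xi> i x0"] norm[OF i(1)] by simp
        then have "(norm (\<xi> i y - \<xi> i x0))\<^sup>2 \<le> 2\<^sup>2" by (intro power_mono) auto
        moreover have "\<delta>\<^sup>2 \<le> (norm (\<xi> i y - \<xi> i x0))\<^sup>2" using i \<delta> by (intro power_mono) auto
        ultimately show ?thesis unfolding q[OF i(1)] \<rho>_def by (intro power_mono) auto
      qed
      moreover have "(\<Prod>j\<in>J. ?q j) \<le> ?q i"
      proof -
        have "(\<Prod>j\<in>J. ?q j) = ?q i * (\<Prod>j\<in>J - {i}. ?q j)"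
          using J i(1) by (rule prod.remove)
        also have "\<dots> \<le> ?q i * 1"
          using q0 i(1) by (intro mult_left_mono prod_le_1) auto
        finally show ?thesis by simp
      qed
      moreover have "0 \<le> (\<Prod>j\<in>J. ?q j)" using q0 by (intro prod_nonneg) auto
      ultimately show ?thesis unfolding P norm_of_real by linarith
    qed
    let ?T = "{\<kappa> \<in> F. \<forall>y\<in>N. c M \<kappa> y = 1}"
    have "norm (\<Sum>\<kappa>\<in>?T. a \<kappa>) \<le> \<rho> ^ M"
      using finF N zero cmult cnorm le by (rule norm_sum_trivial_characters_le)
    \<comment> \<open>By \<open>triv\<close> the characters in \<open>?T\<close> are 1 at
      \<open>x0\<close> too, so the surviving coefficients are nonnegative reals and any single one
      bounds their sum from below.\<close>
    moreover have "(\<Sum>\<kappa>\<in>?T. a \<kappa>) = of_real (\<Sum>\<kappa>\<in>?T. \<Prod>j\<in>J. b M (\<kappa> j))"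
      using triv by (auto simp: a_def intro!: sum.cong)
    ultimately have "(\<Sum>\<kappa>\<in>?T. \<Prod>j\<in>J. b M (\<kappa> j)) \<le> \<rho> ^ M"
      by (simp only: norm_of_real)
    \<comment> \<open>All exponents \<kappa> j - M are 0 here: this is the constant
      character.\<close>
    moreover have "(\<lambda>j\<in>J. M) \<in> ?T"
    proof -
      have "\<xi> j y ^ M * cnj (\<xi> j y) ^ M = 1" if "j \<in> J" for j y
        using norm[OF that, of y] by (simp add: power_mult_distrib[symmetric] complex_norm_square[symmetric])
      then show ?thesis by (auto simp: F_def c_def)
    qed
    then have "(\<Prod>j\<in>J. b M ((\<lambda>j\<in>J. M) j)) \<le> (\<Sum>\<kappa>\<in>?T. \<Prod>j\<in>J. b M (\<kappa> j))"
      by (rule member_le_sum[where f = "\<lambda>\<kappa>. \<Prod>j\<in>J. b M (\<kappa> j)"])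
        (use finF in \<open>auto simp: b_def intro!: prod_nonneg\<close>)
    moreover have "(\<Prod>j\<in>J. b M ((\<lambda>j\<in>J. M) j)) = b M M ^ card J" by simp
    \<comment> \<open>The central binomial coefficient is at least 4^M / (2 * M).\<close>
    moreover have "(1 / (2 * real M)) ^ card J \<le> b M M ^ card J"
      using central_binomial_lower_bound[OF M]
      by (intro power_mono) (auto simp: b_def field_simps)
    ultimately show ?thesis by linarith
  qed
  have "(\<lambda>M. (2 * real M) ^ card J * \<rho> ^ M) \<longlonglongrightarrow> 0"
    using \<rho> by real_asymp
  then have "\<forall>\<^sub>F M in sequentially. (2 * real M) ^ card J * \<rho> ^ M < 1"
    by (rule order_tendstoD) simp
  then obtain M where M: "M > 0" "(2 * real M) ^ card J * \<rho> ^ M < 1"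
    by (metis (no_types, lifting) eventually_at_top_linorder less_Suc_eq_le linorder_not_less order_less_imp_le zero_less_Suc)
  with bound[OF M(1)] show False
    by (simp add: power_divide field_simps)
qed

section \<open>Topologies defined by characters\<close>

definition additive_group :: "'v::ab_group_add set \<Rightarrow> 'v monoid" where
  "additive_group C = \<lparr>carrier = C, monoid.mult = (+), one = 0\<rparr>"

text \<open>\<open>I_add\<close> and \<open>I_minus\<close> make the characters
  \<open>cis o l i\<close> a group under multiplication, so monomials in them belong to the family.
  \<open>separating\<close> makes \<open>emb\<close> injective and hence the topology Hausdorff. The
  family is indexed because \<open>I\<close> also indexes the torus coordinates and bounds the
  weight.\<close>

locale functional_group =
  fixes C :: "'v::ab_group_add set" and I :: "'i set" and l :: "'i \<Rightarrow> 'v \<Rightarrow> real"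
  assumes zero_mem: "0 \<in> C"
    and add_mem: "x \<in> C \<Longrightarrow> y \<in> C \<Longrightarrow> x + y \<in> C"
    and minus_mem: "x \<in> C \<Longrightarrow> - x \<in> C"
    and l_add: "i \<in> I \<Longrightarrow> l i (x + y) = l i x + l i y"
    and I_nonempty: "I \<noteq> {}"
    and I_add: "i \<in> I \<Longrightarrow> j \<in> I \<Longrightarrow> \<exists>k\<in>I. \<forall>x. l k x = l i x + l j x"
    and I_minus: "i \<in> I \<Longrightarrow> \<exists>k\<in>I. \<forall>x. l k x = - l i x"
    and separating: "x \<in> C \<Longrightarrow> x \<noteq> 0 \<Longrightarrow> \<exists>i\<in>I. cis (l i x) \<noteq> 1"
begin

abbreviation G where "G \<equiv> additive_group C"

definition emb :: "'v \<Rightarrow> 'i \<Rightarrow> complex" where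
  "emb x = (\<lambda>i\<in>I. cis (l i x))"

definition bohr_topology :: "'v topology" where
  "bohr_topology = pullback_topology C emb (torus_topology I)"

lemma carrier_G [simp]: "carrier G = C"
  by (simp add: additive_group_def)

lemma comm_group_G: "comm_group G"
proof (rule comm_groupI)
  show "\<exists>y\<in>carrier G. y \<otimes>\<^bsub>G\<^esub> x = \<one>\<^bsub>G\<^esub>" if "x \<in> carrier G" for x
    using that minus_mem by (intro bexI[of _ "- x"]) (auto simp: additive_group_def)
qed (auto simp: additive_group_def zero_mem add_mem ac_simps)

lemma group_G: "group G"
  using comm_group_G by (rule comm_group.axioms)

lemma inv_G: "x \<in> C \<Longrightarrow> inv\<^bsub>G\<^esub> x = - x"
  by (rule group.inv_equality[OF group_G]) (auto simp: additive_group_def minus_mem)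

lemma l_zero: "i \<in> I \<Longrightarrow> l i 0 = 0"
  using l_add[of i 0 0] by simp

lemma l_minus: "i \<in> I \<Longrightarrow> l i (- x) = - l i x"
  using l_add[of i x "- x"] l_zero[of i] by simp

lemma l_diff: "i \<in> I \<Longrightarrow> l i (x - y) = l i x - l i y"
  using l_add[of i x "- y"] l_minus[of i y] by simp

lemma emb_hom: "emb \<in> hom G (torus_group I)"
  by (auto simp: hom_def emb_def torus_group_def additive_group_def l_add cis_mult[symmetric] fun_eq_iff)

lemma emb_inj: "inj_on emb C"
proof (rule inj_onI, rule ccontr)
  fix x y assume xy: "x \<in> C" "y \<in> C" "emb x = emb y" "x \<noteq> y"
  have "x - y \<in> C" using add_mem[of x "- y"] minus_mem[of y] xy by simp
  then obtain i where i: "i \<in> I" "cis (l i (x - y)) \<noteq> 1" using separating[of "x - y"] xy by auto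
  have "cis (l i x) = cis (l i y)" using xy(3) i(1) by (auto simp: emb_def fun_eq_iff split: if_splits)
  with i show False by (simp add: l_diff cis_divide[symmetric])
qed

lemma topological_group_bohr: "topological_group G bohr_topology"
  using topological_group_pullback[OF group_G topological_group_torus emb_hom] emb_inj
  by (simp add: bohr_topology_def)

lemma topspace_bohr [simp]: "topspace bohr_topology = C"
  using topological_group_bohr by (simp add: topological_group_def)

lemma embedding_map_emb: "embedding_map bohr_topology (torus_topology I) emb"
  unfolding bohr_topology_def
  by (rule embedding_map_pullback)
    (auto simp: emb_inj emb_def torus_topology_def)

lemma continuous_map_character:
  assumes "i \<in> I"
  shows "continuous_map bohr_topology euclidean (\<lambda>x. cis (l i x))"
proof -
  have "continuous_map (torus_topology I) euclidean (\<lambda>z. z i)"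
    unfolding torus_topology_def
    using continuous_map_product_projection[OF assms, of "\<lambda>_. top_of_set (sphere (0::complex) 1)"]
    by (simp add: continuous_map_in_subtopology)
  then have "continuous_map bohr_topology euclidean (\<lambda>x. emb x i)"
    unfolding bohr_topology_def by (rule continuous_map_of_pullback)
  with assms show ?thesis by (simp add: emb_def)
qed

lemma openin_character_preimage:
  assumes "i \<in> I" "open V"
  shows "openin bohr_topology {x \<in> C. cis (l i x) \<in> V}"
  using openin_continuous_map_preimage[OF continuous_map_character[OF assms(1)], of V] assms(2)
  by simp

lemma closedin_kernel:
  assumes "i \<in> I"
  shows "closedin bohr_topology {x \<in> C. cis (l i x) = 1}"
  using closedin_continuous_map_preimage[OF continuous_map_character[OF assms], of "{1}"]
  by simp

lemma openin_bohr_nhd: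
  assumes U: "openin bohr_topology U" and x: "x \<in> U"
  shows "\<exists>J \<delta>. finite J \<and> J \<subseteq> I \<and> \<delta> > 0 \<and>
    (\<forall>y\<in>C. (\<forall>j\<in>J. norm (cis (l j y) - cis (l j x)) < \<delta>) \<longrightarrow> y \<in> U)"
proof -
  obtain W where W: "openin (torus_topology I) W" "U = emb -` W \<inter> C"
    using U unfolding bohr_topology_def openin_pullback_topology by blast
  have "emb x \<in> W" using x W by auto
  then obtain V where V: "finite {i \<in> I. V i \<noteq> topspace (top_of_set (sphere (0::complex) 1))}"
      "\<forall>i\<in>I. openin (top_of_set (sphere 0 1)) (V i)" "emb x \<in> Pi\<^sub>E I V" "Pi\<^sub>E I V \<subseteq> W"
    using bspec[OF W(1)[unfolded torus_topology_def openin_product_topology_alt]] by blast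
  let ?J = "{i \<in> I. V i \<noteq> sphere 0 1}"
  have J: "finite ?J" using V(1) by simp
  have "\<exists>e>0. ball (cis (l i x)) e \<inter> sphere 0 1 \<subseteq> V i" if "i \<in> I" for i
  proof -
    have "cis (l i x) \<in> V i" using V(3) that by (auto simp: emb_def PiE_iff)
    then show ?thesis using V(2) that by (simp add: openin_contains_ball)
  qed
  then obtain e where e: "\<And>i. i \<in> I \<Longrightarrow> e i > 0 \<and> ball (cis (l i x)) (e i) \<inter> sphere 0 1 \<subseteq> V i"
    by metis
  \<comment> \<open>The inserted 1 covers the case that no coordinate is restricted.\<close>
  define \<delta> where "\<delta> = Min (insert 1 (e ` ?J))"
  have \<delta>: "\<delta> > 0" "\<And>i. i \<in> ?J \<Longrightarrow> \<delta> \<le> e i"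
    using J e by (auto simp: \<delta>_def)
  have "y \<in> U" if y: "y \<in> C" "\<forall>j\<in>?J. norm (cis (l j y) - cis (l j x)) < \<delta>" for y
  proof -
    have "cis (l i y) \<in> V i" if i: "i \<in> I" for i
    proof (cases "i \<in> ?J")
      case True
      then have "cis (l i y) \<in> ball (cis (l i x)) (e i)"
        using y(2) \<delta>(2)[OF True] by (auto simp: dist_norm norm_minus_commute)
      then show ?thesis using e[OF i] by auto
    qed (use i in auto)
    then have "emb y \<in> Pi\<^sub>E I V" by (auto simp: emb_def)
    then show ?thesis using V(4) W(2) y(1) by auto
  qed
  then show ?thesis using J \<delta>(1) by (intro exI[of _ ?J] exI[of _ \<delta>]) auto
qed

lemma I_nat_multiple:
  assumes "i \<in> I"
  shows "\<exists>k\<in>I. \<forall>x. l k x = real n * l i x"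
proof (induction n)
  case 0
  obtain m where "m \<in> I" "\<forall>x. l m x = - l i x" using I_minus[OF assms] by blast
  with I_add[OF assms this(1)] show ?case by auto
next
  case (Suc n)
  then obtain k where "k \<in> I" "\<forall>x. l k x = real n * l i x" by blast
  with I_add[OF this(1) assms] show ?case by (auto simp: algebra_simps)
qed

text \<open>The coefficients have the shape of the exponents delivered by
  \<open>separating_character\<close>: natural numbers minus one common natural number.\<close>

lemma I_int_combination:
  assumes "finite J" "J \<subseteq> I"
  shows "\<exists>k\<in>I. \<forall>x. l k x = (\<Sum>j\<in>J. (real (m j) - real n) * l j x)"
  using assms
proof (induction J)
  case empty
  obtain i where "i \<in> I" using I_nonempty by blast
  from I_nat_multiple[OF this, of 0] show ?case by simp
next
  case (insert j J)
  then obtain k where k: "k \<in> I" "\<forall>x. l k x = (\<Sum>j\<in>J. (real (m j) - real n) * l j x)" by auto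
  have j: "j \<in> I" using insert by auto
  obtain j' where j': "j' \<in> I" "\<forall>x. l j' x = - l j x" using I_minus[OF j] by blast
  obtain p where p: "p \<in> I" "\<forall>x. l p x = real (m j) * l j x" using I_nat_multiple[OF j] by blast
  obtain q where q: "q \<in> I" "\<forall>x. l q x = real n * l j' x" using I_nat_multiple[OF j'(1)] by blast
  obtain r where r: "r \<in> I" "\<forall>x. l r x = l p x + l q x" using I_add[OF p(1) q(1)] by blast
  obtain s where s: "s \<in> I" "\<forall>x. l s x = l r x + l k x" using I_add[OF r(1) k(1)] by blast
  show ?case
    using s r q p j' k insert by (intro bexI[of _ s]) (auto simp: algebra_simps)
qed

text \<open>A basic neighbourhood of \<open>x\<close> that misses \<open>N\<close> yields finitely
  many characters that keep all of \<open>N\<close> away from \<open>x\<close>.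
  \<open>separating_character\<close> then finds a monomial in them that is trivial on
  \<open>N\<close> but not at \<open>x\<close>, and this monomial is \<open>cis\<close> of an
  integral combination of functionals, hence a member of the family.\<close>

lemma closed_subgroup_separation:
  assumes N: "subgroup N G" "closedin bohr_topology N" and x: "x \<in> C" "x \<notin> N"
  shows "\<exists>k\<in>I. (\<forall>y\<in>N. cis (l k y) = 1) \<and> cis (l k x) \<noteq> 1"
proof -
  have NC: "N \<subseteq> C" using subgroup.subset[OF N(1)] by simp
  have "openin bohr_topology (C - N)"
    using N(2) by (metis closedin_def topspace_bohr)
  then obtain J \<delta> where J: "finite J" "J \<subseteq> I" "\<delta> > 0"
    "\<forall>y\<in>C. (\<forall>j\<in>J. norm (cis (l j y) - cis (l j x)) < \<delta>) \<longrightarrow> y \<in> C - N"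
    using openin_bohr_nhd[of "C - N" x] x by blast
  have far: "\<exists>j\<in>J. \<delta> \<le> norm (cis (l j y) - cis (l j x))" if "y \<in> N" for y
    using J(4) NC that by (metis Diff_iff linorder_not_less subset_iff)
  have Nadd: "y + z \<in> N" if "y \<in> N" "z \<in> N" for y z
    using subgroup.m_closed[OF N(1) that] by (simp add: additive_group_def)
  have Nzero: "0 \<in> N"
    using subgroup.one_closed[OF N(1)] by (simp add: additive_group_def)
  have "\<exists>\<kappa> M. (\<forall>y\<in>N. (\<Prod>j\<in>J. cis (l j y) ^ \<kappa> j * cnj (cis (l j y)) ^ M) = 1) \<and>
               (\<Prod>j\<in>J. cis (l j x) ^ \<kappa> j * cnj (cis (l j x)) ^ M) \<noteq> 1"
    using J(1) Nadd Nzero _ _ J(3) far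
    by (rule separating_character) (use J(2) in \<open>auto simp: l_add cis_mult[symmetric]\<close>)
  then obtain \<kappa> M where \<kappa>: "\<forall>y\<in>N. (\<Prod>j\<in>J. cis (l j y) ^ \<kappa> j * cnj (cis (l j y)) ^ M) = 1"
      "(\<Prod>j\<in>J. cis (l j x) ^ \<kappa> j * cnj (cis (l j x)) ^ M) \<noteq> 1" by blast
  have *: "(\<Prod>j\<in>J. cis (l j y) ^ \<kappa> j * cnj (cis (l j y)) ^ M)
      = cis (\<Sum>j\<in>J. (real (\<kappa> j) - real M) * l j y)" for y
    using J(1)
  proof (induction J)
    case (insert j J)
    have "cis (l j y) ^ \<kappa> j * cnj (cis (l j y)) ^ M = cis ((real (\<kappa> j) - real M) * l j y)"
      unfolding cis_cnj Complex.DeMoivre cis_mult by (simp add: algebra_simps)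
    with insert show ?case by (simp add: cis_mult)
  qed simp
  obtain k where "k \<in> I" "\<forall>x. l k x = (\<Sum>j\<in>J. (real (\<kappa> j) - real M) * l j x)"
    using I_int_combination[OF J(1,2)] by blast
  with \<kappa> show ?thesis unfolding * by (intro bexI[of _ k]) auto
qed

text \<open>With a countable base of the plane for each coordinate, basic open sets are coded by
  finite subsets of \<open>I \<times> \<A>\<close>, a set of cardinality |I|.\<close>

lemma exists_base_card_le:
  assumes "infinite I"
  shows "\<exists>\<B>. topology_base bohr_topology \<B> \<and> |\<B>| \<le>o |I|"
proof -
  obtain \<A> :: "complex set set" where \<A>: "countable \<A>" "topological_basis \<A>"
    using ex_countable_basis by blast
  define B where "B F = {x \<in> C. \<forall>(i, V)\<in>F. cis (l i x) \<in> V}" for F :: "('i \<times> complex set) set"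
  let ?\<B> = "B ` Fpow (I \<times> \<A>)"
  have B_open: "openin bohr_topology (B F)" if "finite F" "F \<subseteq> I \<times> \<A>" for F
    using that
  proof (induction F)
    case empty
    then show ?case using openin_topspace[of bohr_topology] by (simp add: B_def)
  next
    case (insert p F)
    obtain i V where p: "p = (i, V)" by fastforce
    then have "openin bohr_topology {x \<in> C. cis (l i x) \<in> V}"
      using insert \<A>(2) topological_basis_open by (intro openin_character_preimage) auto
    moreover have "B (insert p F) = {x \<in> C. cis (l i x) \<in> V} \<inter> B F"
      by (auto simp: B_def p)
    ultimately show ?case using insert by auto
  qed
  have "topology_base bohr_topology ?\<B>"
    unfolding topology_base_def
  proof (intro conjI allI impI)
    show "\<forall>V\<in>?\<B>. openin bohr_topology V"
      using B_open by (auto simp: Fpow_def)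
    fix U x assume U: "openin bohr_topology U \<and> x \<in> U"
    then have xC: "x \<in> C" using openin_subset by fastforce
    obtain J \<delta> where J: "finite J" "J \<subseteq> I" "\<delta> > 0"
      "\<forall>y\<in>C. (\<forall>j\<in>J. norm (cis (l j y) - cis (l j x)) < \<delta>) \<longrightarrow> y \<in> U"
      using openin_bohr_nhd[of U x] U by blast
    have "\<exists>V\<in>\<A>. cis (l j x) \<in> V \<and> V \<subseteq> ball (cis (l j x)) \<delta>" for j
      using topological_basisE[OF \<A>(2) open_ball, of "cis (l j x)"] J(3) centre_in_ball by metis
    then obtain V where V: "\<And>j. V j \<in> \<A> \<and> cis (l j x) \<in> V j \<and> V j \<subseteq> ball (cis (l j x)) \<delta>"
      by metis
    let ?F = "(\<lambda>j. (j, V j)) ` J"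
    have "?F \<in> Fpow (I \<times> \<A>)" using J V by (auto simp: Fpow_def)
    moreover have "x \<in> B ?F" using V xC by (auto simp: B_def)
    moreover have "B ?F \<subseteq> U"
    proof
      fix y assume y: "y \<in> B ?F"
      have "norm (cis (l j y) - cis (l j x)) < \<delta>" if "j \<in> J" for j
      proof -
        have "cis (l j y) \<in> ball (cis (l j x)) \<delta>" using V[of j] y that by (auto simp: B_def)
        then show ?thesis by (simp add: dist_norm norm_minus_commute)
      qed
      then show "y \<in> U" using J(4) y by (auto simp: B_def)
    qed
    ultimately show "\<exists>V\<in>?\<B>. x \<in> V \<and> V \<subseteq> U" by blast
  qed
  moreover have "|?\<B>| \<le>o |I|"
  proof -
    have Ane: "\<A> \<noteq> {}" using topological_basisE[OF \<A>(2) open_UNIV, of 0] by auto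
    have "|\<A>| \<le>o |I|"
      using \<A>(1) assms unfolding countable_def infinite_iff_card_of_nat
      by (meson card_of_ordLeq ordLeq_transitive subset_UNIV)
    then have Times: "|I \<times> \<A>| =o |I|" using assms Ane by (simp add: card_of_Times_infinite)
    have "infinite (I \<times> \<A>)" using assms Ane by (auto simp: finite_cartesian_product_iff)
    then have "|Fpow (I \<times> \<A>)| =o |I \<times> \<A>|" by (rule card_of_Fpow_infinite)
    with Times show ?thesis
      using card_of_image ordIso_transitive ordLeq_ordIso_trans by blast
  qed
  ultimately show ?thesis by blast
qed

lemma trivial_group_Mod_carrier: "trivial_group (G Mod carrier G)"
proof -
  interpret comm_group G by (rule comm_group_G)
  have "carrier G \<lhd> G" using subgroup_self by (rule subgroup_imp_normal)
  then have "group (G Mod carrier G)" by (rule normal.factorgroup_is_group)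
  moreover have "rcosets\<^bsub>G\<^esub> carrier G = {carrier G}"
    using coset_join2[OF _ subgroup_self] one_closed unfolding RCOSETS_def by blast
  ultimately show ?thesis by (simp add: trivial_group_def FactGroup_def)
qed

section \<open>Quotients by closed subgroups\<close>

text \<open>\<open>kill\<close> abstracts the operator argument. The character it supplies is
  trivial on \<open>N\<close>, so it descends to the quotient; the set where it differs from 1 is
  open and nonempty there and misses the countable set.\<close>

lemma non_separable_quotients:
  assumes kill: "\<And>i D x. i \<in> I \<Longrightarrow> countable D \<Longrightarrow> D \<subseteq> C \<Longrightarrow> x \<in> C \<Longrightarrow> cis (l i x) \<noteq> 1 \<Longrightarrow>
      \<exists>k\<in>I. (\<forall>y\<in>C. cis (l i y) = 1 \<longrightarrow> cis (l k y) = 1) \<and> (\<forall>d\<in>D. cis (l k d) = 1) \<and>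
            (\<exists>y\<in>C. cis (l k y) \<noteq> 1)"
    and N: "N \<lhd> G" "closedin bohr_topology N"
  shows "trivial_group (G Mod N) \<or> \<not> separable_space (coset_topology G bohr_topology N)"
proof (cases "N = C")
  case True
  then show ?thesis using trivial_group_Mod_carrier by simp
next
  case False
  interpret comm_group G by (rule comm_group_G)
  have sub: "subgroup N G" using N(1) by (rule normal_imp_subgroup)
  have NC: "N \<subseteq> C" using subgroup.subset[OF sub] by simp
  have Nzero: "0 \<in> N"
    using subgroup.one_closed[OF sub] by (simp add: additive_group_def)
  obtain x where x: "x \<in> C" "x \<notin> N" using False NC by blast
  obtain i where i: "i \<in> I" "\<forall>y\<in>N. cis (l i y) = 1" "cis (l i x) \<noteq> 1"
    using closed_subgroup_separation[OF sub N(2) x] by blast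
  define q where "q x = N #>\<^bsub>G\<^esub> x" for x
  have q: "q x = (\<lambda>n. n + x) ` N" for x
    by (auto simp: q_def r_coset_def additive_group_def)
  let ?Q = "coset_topology G bohr_topology N"
  have top: "topspace ?Q = q ` C"
    by (simp add: coset_topology_def topspace_quotient_topology q_def)
  have "\<not> separable_space ?Q"
  proof
    assume "separable_space ?Q"
    then obtain E where E: "countable E" "E \<subseteq> q ` C" "?Q closure_of E = topspace ?Q"
      unfolding separable_space_def top by blast
    \<comment> \<open>One representative for each point of the supposedly dense set.\<close>
    define D where "D = inv_into C q ` E"
    have D: "countable D" "D \<subseteq> C"
      using E inv_into_into[of _ q C] by (auto simp: D_def)
    then obtain k where k: "k \<in> I" "\<forall>y\<in>C. cis (l i y) = 1 \<longrightarrow> cis (l k y) = 1"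
        "\<forall>d\<in>D. cis (l k d) = 1" "\<exists>y\<in>C. cis (l k y) \<noteq> 1"
      using kill[OF i(1) D x(1) i(3)] by blast
    have inv: "cis (l k y) = cis (l k z)" if "q y = q z" for y z
    proof -
      have "0 + y \<in> q y" unfolding q using Nzero by blast
      then have "y \<in> (\<lambda>n. n + z) ` N" using that q by simp
      then obtain n where "n \<in> N" "y = n + z" by blast
      moreover have "cis (l k n) = 1" using \<open>n \<in> N\<close> i(2) k(2) NC by blast
      ultimately show ?thesis by (simp add: l_add[OF k(1)] cis_mult[symmetric])
    qed
    let ?O = "{y \<in> C. cis (l k y) \<noteq> 1}"
    have "openin bohr_topology {y \<in> C. cis (l k y) \<in> - {1}}"
      using k(1) by (rule openin_character_preimage) auto
    \<comment> \<open>The set \<open>?O\<close> is a union of cosets, because the character is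
      constant on cosets by \<open>inv\<close>; so its image is open.\<close>
    moreover have "{y \<in> C. q y \<in> q ` ?O} = {y \<in> C. cis (l k y) \<in> - {1}}"
    proof (intro subset_antisym subsetI)
      fix y assume "y \<in> {y \<in> C. q y \<in> q ` ?O}"
      then obtain z where "y \<in> C" "q y = q z" "cis (l k z) \<noteq> 1" by blast
      then show "y \<in> {y \<in> C. cis (l k y) \<in> - {1}}" using inv[of y z] by simp
    qed blast
    ultimately have "openin ?Q (q ` ?O)"
      unfolding coset_topology_def q_def[symmetric] openin_quotient_topology topspace_bohr
      by (intro conjI) (blast, simp)
    moreover have "q ` ?O \<noteq> {}" using k(4) by auto
    ultimately have "E \<inter> q ` ?O \<noteq> {}"
      using E(3) unfolding dense_intersects_open by blast
    then obtain y where y: "y \<in> C" "cis (l k y) \<noteq> 1" "q y \<in> E" by auto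
    then have "q (inv_into C q (q y)) = q y" by (intro f_inv_into_f) auto
    moreover have "inv_into C q (q y) \<in> D" using y by (auto simp: D_def)
    ultimately show False using inv k(3) y(2) by metis
  qed
  then show ?thesis ..
qed

end

section \<open>Rational linear operators on the reals\<close>

definition rat_linear :: "(real \<Rightarrow> real) \<Rightarrow> bool" where
  "rat_linear f \<longleftrightarrow> (\<forall>x y. f (x + y) = f x + f y) \<and> (\<forall>q x. f (of_rat q * x) = of_rat q * f x)"

interpretation rat_space: vector_space_pair "\<lambda>q (x::real). of_rat q * x" "\<lambda>q (x::real). of_rat q * x"
  by unfold_locales (simp_all add: algebra_simps of_rat_add of_rat_mult)

lemma linear_iff_rat_linear:
  "Vector_Spaces.linear (\<lambda>q (x::real). of_rat q * x) (\<lambda>q (x::real). of_rat q * x) f \<longleftrightarrow> rat_linear f"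
  by (simp add: Vector_Spaces.linear_iff rat_linear_def rat_space.vs1.vector_space_axioms)

lemma rat_linear_add: "rat_linear f \<Longrightarrow> f (x + y) = f x + f y"
  and rat_linear_scale: "rat_linear f \<Longrightarrow> f (of_rat q * x) = of_rat q * f x"
  by (auto simp: rat_linear_def)

lemma rat_linear_zero: "rat_linear f \<Longrightarrow> f 0 = 0"
  using rat_linear_add[of f 0 0] by simp

lemma rat_linear_comp: "rat_linear f \<Longrightarrow> rat_linear g \<Longrightarrow> rat_linear (\<lambda>x. f (g x))"
  by (simp add: rat_linear_def)

text \<open>Rational combinations of a countable set are coded by lists and form a countable
  subspace. Repeated entries are allowed, so that addition is concatenation.\<close>

lemma uncountable_hamel_basis:
  assumes "rat_space.vs1.span B = UNIV"
  shows "uncountable B"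
proof
  assume B: "countable B"
  define f where "f ps = (\<Sum>(q, b)\<leftarrow>ps. of_rat q * b)" for ps :: "(rat \<times> real) list"
  define S where "S = f ` lists (UNIV \<times> B)"
  have "rat_space.vs1.subspace S"
  proof (rule rat_space.vs1.subspaceI)
    show "0 \<in> S" unfolding S_def by (rule image_eqI[of _ _ "[]"]) (auto simp: f_def)
    fix x y assume "x \<in> S" "y \<in> S"
    then obtain ps qs where "ps \<in> lists (UNIV \<times> B)" "x = f ps" "qs \<in> lists (UNIV \<times> B)" "y = f qs"
      by (auto simp: S_def)
    then show "x + y \<in> S" unfolding S_def by (intro image_eqI[of _ _ "ps @ qs"]) (auto simp: f_def)
  next
    fix c x assume "x \<in> S"
    then obtain ps where ps: "ps \<in> lists (UNIV \<times> B)" "x = f ps" by (auto simp: S_def)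
    have "of_rat c * f ps = f (map (\<lambda>(q, b). (c * q, b)) ps)"
      by (induction ps) (auto simp: f_def of_rat_mult algebra_simps)
    then show "of_rat c * x \<in> S"
      unfolding S_def ps(2) by (rule image_eqI) (use ps(1) in \<open>auto simp: in_lists_conv_set\<close>)
  qed
  moreover have "B \<subseteq> S"
  proof
    fix b assume "b \<in> B"
    then show "b \<in> S" unfolding S_def by (intro image_eqI[of _ _ "[(1, b)]"]) (auto simp: f_def)
  qed
  ultimately have "rat_space.vs1.span B \<subseteq> S" by (intro rat_space.vs1.span_minimal)
  moreover have "countable S"
    unfolding S_def using B by (intro countable_image countable_lists countable_SIGMA) auto
  ultimately have "countable (UNIV :: real set)"
    using assms countable_subset by metis
  then show False using uncountable_UNIV_real by blast
qed

text \<open>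
  Label a Hamel basis \<open>h S\<close> by the finite subsets \<open>S\<close> of an uncountable set \<open>B\<close>. Then \<open>del u\<close> maps
  \<open>h S\<close> to \<open>h (S - u)\<close> if \<open>u \<subseteq> S\<close> and to \<open>0\<close> otherwise, \<open>ins g\<close> maps \<open>h S\<close> to \<open>h (insert g S)\<close>, and
  \<open>supp x\<close> is the union of the labels occurring in the expansion of \<open>x\<close>.
\<close>

locale hamel_operators =
  fixes B :: "real set" and del :: "real set \<Rightarrow> real \<Rightarrow> real" and ins :: "real \<Rightarrow> real \<Rightarrow> real"
    and supp :: "real \<Rightarrow> real set"
  assumes uncountable_B: "uncountable B"
    and finite_supp: "finite (supp x)"
    and rat_linear_del: "rat_linear (del u)"
    and rat_linear_ins: "rat_linear (ins g)"
    and del_empty: "del {} x = x"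
    and del_del: "g \<in> B \<Longrightarrow> u \<in> Fpow B \<Longrightarrow> g \<notin> u \<Longrightarrow> del {g} (del u x) = del (insert g u) x"
    and del_not_supp: "g \<in> B \<Longrightarrow> g \<notin> supp x \<Longrightarrow> del {g} x = 0"
    and del_ins: "g \<in> B \<Longrightarrow> u \<in> Fpow B \<Longrightarrow> g \<notin> u \<Longrightarrow> g \<notin> supp x \<Longrightarrow> del {g} (del u (ins g x)) = del u x"

text \<open>The Hamel basis \<open>B\<close> itself supplies the elements of the labels: being
  infinite, it is in bijection with \<open>Fpow B\<close> through \<open>h\<close>, with inverse
  \<open>k\<close>. On basis vectors the identities are statements about finite sets.\<close>

lemma exists_hamel_operators: "\<exists>B del ins supp. hamel_operators B del ins supp"
proof -
  define B where "B = rat_space.vs1.extend_basis {}"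
  have ind: "rat_space.vs1.independent B" and span: "rat_space.vs1.span B = UNIV"
    unfolding B_def
    by (simp_all add: rat_space.vs1.independent_extend_basis rat_space.vs1.span_extend_basis
        rat_space.vs1.independent_empty)
  have unc: "uncountable B" using span by (rule uncountable_hamel_basis)
  then have "infinite B" using countable_finite by blast
  then have "Fpow B \<approx> B" by (rule eqpoll_Fpow)
  then obtain h where h: "bij_betw h (Fpow B) B" by (auto simp: eqpoll_def)
  define k where "k = inv_into (Fpow B) h"
  have k: "k b \<in> Fpow B" "h (k b) = b" if "b \<in> B" for b
    using h that by (auto simp: k_def bij_betw_def inv_into_into f_inv_into_f)
  have kh [simp]: "k (h S) = S" if "S \<in> Fpow B" for S
    using h that by (auto simp: k_def bij_betw_def)
  have hB: "h S \<in> B" if "S \<in> Fpow B" for S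
    using h that by (auto simp: bij_betw_def)
  define del where "del u = rat_space.construct B (\<lambda>b. if u \<subseteq> k b then h (k b - u) else 0)" for u
  define ins where "ins g = rat_space.construct B (\<lambda>b. h (insert g (k b)))" for g
  have del_lin: "rat_linear (del u)" for u
    unfolding del_def linear_iff_rat_linear[symmetric] by (rule rat_space.linear_construct[OF ind])
  have ins_lin: "rat_linear (ins u)" for u
    unfolding ins_def linear_iff_rat_linear[symmetric] by (rule rat_space.linear_construct[OF ind])
  have del_h: "del u b = (if u \<subseteq> k b then h (k b - u) else 0)" if "b \<in> B" for u b
    unfolding del_def by (rule rat_space.construct_basis[OF ind that])
  have ins_h: "ins g b = h (insert g (k b))" if "b \<in> B" for g b
    unfolding ins_def by (rule rat_space.construct_basis[OF ind that])
  have diff: "S - u \<in> Fpow B" if "S \<in> Fpow B" for S u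
    using that by (auto simp: Fpow_def)
  have insF: "insert g S \<in> Fpow B" if "S \<in> Fpow B" "g \<in> B" for S g
    using that by (auto simp: Fpow_def)
  have "\<exists>s. finite s \<and> x \<in> rat_space.vs1.span {b \<in> B. k b \<subseteq> s}" for x
  proof -
    have "x \<in> rat_space.vs1.span B" by (simp add: span)
    then obtain t r where t: "finite t" "t \<subseteq> B" "x = (\<Sum>a\<in>t. of_rat (r a) * a)"
      unfolding rat_space.vs1.span_explicit by blast
    have "x \<in> rat_space.vs1.span {b \<in> B. k b \<subseteq> \<Union> (k ` t)}"
      unfolding t(3)
      by (intro rat_space.vs1.span_sum rat_space.vs1.span_scale rat_space.vs1.span_base)
        (use t(2) in auto)
    moreover have "finite (\<Union> (k ` t))" using t k(1) by (auto simp: Fpow_def)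
    ultimately show ?thesis by blast
  qed
  then obtain supp where supp: "\<And>x. finite (supp x)"
      "\<And>x. x \<in> rat_space.vs1.span {b \<in> B. k b \<subseteq> supp x}" by metis
  \<comment> \<open>This turns hypotheses on \<open>supp x\<close> into hypotheses on labels: an
    identity at \<open>x\<close> need only be checked at basis vectors labelled inside
    \<open>supp x\<close>.\<close>
  have eq: "f x = f' x" if "rat_linear f" "rat_linear f'"
    "\<And>b. b \<in> B \<Longrightarrow> k b \<subseteq> supp x \<Longrightarrow> f b = f' b" for f f' x
    using rat_space.linear_eq_on[of f f' x "{b \<in> B. k b \<subseteq> supp x}"] supp(2) that
    by (auto simp: linear_iff_rat_linear)
  have "hamel_operators B del ins supp"
  proof
    show "del {} x = x" for x
    proof (rule eq[of "del {}" "\<lambda>x. x"])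
      show "rat_linear (\<lambda>x. x)" by (simp add: rat_linear_def)
    qed (auto simp: del_lin del_h k)
    show "del {g} (del u x) = del (insert g u) x" if "g \<in> B" "u \<in> Fpow B" "g \<notin> u" for g u x
    proof (rule eq[of "\<lambda>x. del {g} (del u x)"])
      fix b assume "b \<in> B"
      show "del {g} (del u b) = del (insert g u) b"
      proof (cases "u \<subseteq> k b")
        case True
        have "k b - u - {g} = k b - insert g u" by blast
        with True show ?thesis
          using \<open>b \<in> B\<close> that by (simp add: del_h hB diff k(1))
      qed (use \<open>b \<in> B\<close> in \<open>simp add: del_h rat_linear_zero[OF del_lin]\<close>)
    qed (simp_all add: rat_linear_comp del_lin)
    show "del {g} x = 0" if "g \<in> B" "g \<notin> supp x" for g x
    proof (rule eq[of "del {g}" "\<lambda>_. 0"])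
      show "rat_linear (\<lambda>x. 0)" by (simp add: rat_linear_def)
    qed (use that in \<open>auto simp: del_lin del_h\<close>)
    show "del {g} (del u (ins g x)) = del u x" if "g \<in> B" "u \<in> Fpow B" "g \<notin> u" "g \<notin> supp x" for g u x
    proof (rule eq[of "\<lambda>x. del {g} (del u (ins g x))"])
      fix b assume b: "b \<in> B" "k b \<subseteq> supp x"
      \<comment> \<open>\<open>ins g\<close> adds g to the label, \<open>del u\<close> leaves it
        there as g is not in u, and \<open>del {g}\<close> removes it. If u is not contained in the
        label, both sides are 0.\<close>
      then have "g \<notin> k b" using that by blast
      moreover have "insert g (k b) - u - {g} = k b - u" if "g \<notin> k b"
        using that by blast
      moreover have "u \<subseteq> insert g (k b) \<longleftrightarrow> u \<subseteq> k b" using that by blast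
      ultimately show "del {g} (del u (ins g b)) = del u b"
        using b that by (simp add: del_h ins_h hB insF diff k(1) rat_linear_zero[OF del_lin])
    qed (rule rat_linear_comp[OF del_lin rat_linear_comp[OF del_lin ins_lin]], rule del_lin)
  qed (use unc supp del_lin ins_lin in auto)
  then show ?thesis by blast
qed

section \<open>The direct sum of copies of the reals\<close>

lemma cis_eq_1_iff_multiple: "cis t = 1 \<longleftrightarrow> (\<exists>n::int. t = 2 * pi * of_int n)"
proof -
  have "cis t = 1 \<longleftrightarrow> sin t = 0 \<and> cos t = 1"
    by (auto simp: complex_eq_iff)
  also have "\<dots> \<longleftrightarrow> (\<exists>n::int. t = 2 * pi * of_int n)"
    using cos_one_2pi_int[of t] by (metis cos_one_sin_zero mult.commute mult.left_commute)
  finally show ?thesis .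
qed

lemma exists_rat_cis_neq_1:
  assumes "r \<noteq> 0"
  shows "\<exists>q::rat. cis (of_rat q * r) \<noteq> 1"
proof -
  \<comment> \<open>This choice puts |q * r| strictly between 0 and 1, hence below 2 pi.\<close>
  obtain q :: rat where q: "0 < (of_rat q :: real)" "of_rat q < 1 / \<bar>r\<bar>"
    using of_rat_dense[of 0 "1 / \<bar>r\<bar>"] assms by auto
  have "cis (of_rat q * r) \<noteq> 1"
  proof
    assume "cis (of_rat q * r) = 1"
    then obtain n :: int where n: "of_rat q * r = 2 * pi * of_int n"
      unfolding cis_eq_1_iff_multiple by blast
    have lt: "\<bar>of_rat q * r\<bar> < 1" using q assms by (simp add: abs_mult field_simps)
    have "n \<noteq> 0" using n q assms by auto
    then have "1 \<le> \<bar>real_of_int n\<bar>" by linarith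
    then have "2 * pi * 1 \<le> 2 * pi * \<bar>real_of_int n\<bar>" by (intro mult_left_mono) auto
    also have "\<dots> = \<bar>of_rat q * r\<bar>" unfolding n by (simp add: abs_mult)
    finally show False using lt pi_gt3 by linarith
  qed
  then show ?thesis ..
qed

text \<open>
  The group is the direct sum of \<open>A\<close> copies of the reals; its functionals are the rational combinations
  of the maps \<open>x \<mapsto> del u (x a)\<close>, coded by lists of triples \<open>(q, a, u)\<close> and enumerated by \<open>e\<close>.
\<close>

locale direct_sum_functionals = hamel_operators B del ins supp for B del ins supp +
  fixes A :: "'a set" and e :: "'a \<Rightarrow> (rat \<times> 'a \<times> real set) list"
  assumes infinite_A: "infinite A"
    and e_range: "e ` A = lists (UNIV \<times> A \<times> Fpow B)"
begin

text \<open>Real vectors are coded as complex ones so that they have the type of the torus elements,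
  as \<open>precompact_groupI\<close> requires.\<close>

definition carr :: "('a \<Rightarrow> complex) set" where
  "carr = {x. (\<forall>a. Im (x a) = 0) \<and> finite {a. x a \<noteq> 0} \<and> {a. x a \<noteq> 0} \<subseteq> A}"

text \<open>With lists, addition of functionals is concatenation, and composition with
  \<open>del {g}\<close> for g outside all labels is a \<open>map\<close>.\<close>

definition ev :: "(rat \<times> 'a \<times> real set) list \<Rightarrow> ('a \<Rightarrow> complex) \<Rightarrow> real" where
  "ev p x = (\<Sum>(q, a, u)\<leftarrow>p. of_rat q * del u (Re (x a)))"

lemma ev_simps [simp]:
  "ev [] x = 0" "ev ((q, a, u) # p) x = of_rat q * del u (Re (x a)) + ev p x"
  "ev (p @ p') x = ev p x + ev p' x"
  by (simp_all add: ev_def)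

lemma ev_add: "ev p (x + y) = ev p x + ev p y"
  by (induction p) (auto simp: rat_linear_add[OF rat_linear_del] algebra_simps)

lemma e_mem: "i \<in> A \<Longrightarrow> e i \<in> lists (UNIV \<times> A \<times> Fpow B)"
  using e_range by blast

lemma e_surj: "p \<in> lists (UNIV \<times> A \<times> Fpow B) \<Longrightarrow> \<exists>i\<in>A. e i = p"
  using e_range by (metis imageE)

sublocale functional_group carr A "\<lambda>i. ev (e i)"
proof
  show "0 \<in> carr" by (simp add: carr_def)
  show "x + y \<in> carr" if "x \<in> carr" "y \<in> carr" for x y
  proof -
    have sub: "{a. (x + y) a \<noteq> 0} \<subseteq> {a. x a \<noteq> 0} \<union> {a. y a \<noteq> 0}" by auto
    moreover have "finite ({a. x a \<noteq> 0} \<union> {a. y a \<noteq> 0})" using that by (simp add: carr_def)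
    ultimately have "finite {a. (x + y) a \<noteq> 0}" by (rule finite_subset)
    moreover have "{a. (x + y) a \<noteq> 0} \<subseteq> A"
      using sub that by (simp only: carr_def mem_Collect_eq) blast
    ultimately show ?thesis using that by (simp add: carr_def)
  qed
  show "- x \<in> carr" if "x \<in> carr" for x using that by (auto simp: carr_def)
  show "ev (e i) (x + y) = ev (e i) x + ev (e i) y" for i x y by (rule ev_add)
  show "A \<noteq> {}" using infinite_A by auto
  show "\<exists>k\<in>A. \<forall>x. ev (e k) x = ev (e i) x + ev (e j) x" if "i \<in> A" "j \<in> A" for i j
  proof -
    have "e i @ e j \<in> lists (UNIV \<times> A \<times> Fpow B)"
      using e_mem[OF that(1)] e_mem[OF that(2)] by (simp only: append_in_lists_conv)
    then obtain k where "k \<in> A" "e k = e i @ e j" using e_surj by blast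
    then show ?thesis by (intro bexI[of _ k]) simp_all
  qed
  show "\<exists>k\<in>A. \<forall>x. ev (e k) x = - ev (e i) x" if "i \<in> A" for i
  proof -
    let ?p = "map (\<lambda>(q, a, u). (- q, a, u)) (e i)"
    have "?p \<in> lists (UNIV \<times> A \<times> Fpow B)"
      using e_mem[OF that] by (auto simp: in_lists_conv_set)
    then obtain k where "k \<in> A" "e k = ?p" using e_surj by blast
    moreover have "ev (map (\<lambda>(q, a, u). (- q, a, u)) p) x = - ev p x" for p x
      by (induction p) (auto simp: of_rat_minus)
    ultimately show ?thesis by (intro bexI[of _ k]) simp_all
  qed
  show "\<exists>i\<in>A. cis (ev (e i) x) \<noteq> 1" if x: "x \<in> carr" "x \<noteq> 0" for x
  proof -
    obtain a where a: "x a \<noteq> 0" using x(2) by (auto simp: fun_eq_iff)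
    then have "a \<in> A" "Re (x a) \<noteq> 0" using x(1) by (auto simp: carr_def complex_eq_iff)
    obtain q where q: "cis (of_rat q * Re (x a)) \<noteq> 1"
      using exists_rat_cis_neq_1[OF \<open>Re (x a) \<noteq> 0\<close>] by blast
    obtain i where "i \<in> A" "e i = [(q, a, {})]"
      using e_surj[of "[(q, a, {})]"] \<open>a \<in> A\<close> by (auto simp: Fpow_def)
    with q show ?thesis by (intro bexI[of _ i]) (auto simp: del_empty)
  qed
qed

lemma single_mem: "a \<in> A \<Longrightarrow> (\<lambda>_. 0)(a := of_real r) \<in> carr"
  by (auto simp: carr_def)

text \<open>The new functional is \<open>del {g}\<close> after the old one. Its nontriviality is
  carried over from \<open>x\<close>: after applying \<open>ins g\<close> to all coordinates of
  \<open>x\<close>, it takes the value that the old one has at \<open>x\<close>.\<close>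

lemma exists_killing_functional:
  assumes i: "i \<in> A" and D: "countable D" "D \<subseteq> carr" and x: "x \<in> carr" "cis (ev (e i) x) \<noteq> 1"
  shows "\<exists>k\<in>A. (\<forall>y\<in>carr. cis (ev (e i) y) = 1 \<longrightarrow> cis (ev (e k) y) = 1) \<and>
           (\<forall>d\<in>D. cis (ev (e k) d) = 1) \<and> (\<exists>y\<in>carr. cis (ev (e k) y) \<noteq> 1)"
proof -
  define p where "p = e i"
  have p: "p \<in> lists (UNIV \<times> A \<times> Fpow B)" using e_mem[OF i] by (simp add: p_def)
  \<comment> \<open>Avoiding these sets lets \<open>del {g}\<close> kill 2 pi, keeps g out of all
    labels of \<open>p\<close>, lets \<open>del {g}\<close> kill the values on \<open>D\<close>, and
    makes \<open>del_ins\<close> applicable to the coordinates of \<open>x\<close>, in this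
    order.\<close>
  define S where "S = supp (2 * pi) \<union> (\<Union>(q, a, u)\<in>set p. u) \<union> (\<Union>d\<in>D. supp (ev p d)) \<union>
    (\<Union>(q, a, u)\<in>set p. supp (Re (x a)))"
  have "countable S"
  proof -
    have "countable (\<Union>d\<in>D. supp (ev p d))"
      using D(1) finite_supp by (blast intro: countable_UN countable_finite)
    moreover have "finite u" if "(q, a, u) \<in> set p" for q a u
      using p that by (auto simp: in_lists_conv_set Fpow_def)
    then have "finite (\<Union>(q, a, u)\<in>set p. u)" by auto
    moreover have "finite (\<Union>(q, a, u)\<in>set p. supp (Re (x a)))"
      using finite_supp by auto
    ultimately show ?thesis
      unfolding S_def by (simp add: countable_finite finite_supp)
  qed
  then obtain g where g: "g \<in> B" "g \<notin> S"
    using uncountable_B countable_subset[of B S] by (metis subsetI)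
  let ?p = "map (\<lambda>(q, a, u). (q, a, insert g u)) p"
  have "?p \<in> lists (UNIV \<times> A \<times> Fpow B)"
    using p g(1) by (fastforce simp: in_lists_conv_set Fpow_def)
  then obtain k where k: "k \<in> A" "e k = ?p" using e_surj by blast
  have lin: "rat_linear (del {g})" by (rule rat_linear_del)
  have kev: "ev (e k) y = del {g} (ev p y)" for y
  proof -
    have "ev (map (\<lambda>(q, a, u). (q, a, insert g u)) r) y = del {g} (ev r y)"
      if "set r \<subseteq> set p" for r
      using that
    proof (induction r)
      case Nil
      then show ?case by (simp add: rat_linear_zero[OF lin])
    next
      case (Cons z r)
      obtain q a u where z: "z = (q, a, u)" by (cases z)
      have "z \<in> set p" using Cons.prems by simp
      then have "u \<in> Fpow B" "g \<notin> u" using p g(2) z by (auto simp: in_lists_conv_set S_def)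
      with Cons g(1) show ?case
        by (simp add: z rat_linear_add[OF lin] rat_linear_scale[OF lin] del_del)
    qed
    then show ?thesis by (simp add: k(2))
  qed
  have "cis (ev (e k) y) = 1" if y: "cis (ev (e i) y) = 1" for y
  proof -
    obtain n :: int where "ev p y = 2 * pi * of_int n"
      using y unfolding p_def[symmetric] cis_eq_1_iff_multiple by blast
    \<comment> \<open>As a rational multiple of 2 pi the value is accessible to rational
      linearity.\<close>
    then have "ev p y = of_rat (of_int n) * (2 * pi)" by simp
    then have "del {g} (ev p y) = of_rat (of_int n) * del {g} (2 * pi)"
      by (simp only: rat_linear_scale[OF lin])
    moreover have "del {g} (2 * pi) = 0" using g by (intro del_not_supp) (auto simp: S_def)
    ultimately show ?thesis by (simp add: kev)
  qed
  moreover have "cis (ev (e k) d) = 1" if "d \<in> D" for d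
  proof -
    have "del {g} (ev p d) = 0" using g that by (intro del_not_supp) (auto simp: S_def)
    then show ?thesis by (simp add: kev)
  qed
  moreover have "\<exists>y\<in>carr. cis (ev (e k) y) \<noteq> 1"
  proof -
    define y where "y a = complex_of_real (ins g (Re (x a)))" for a
    have sub: "{a. y a \<noteq> 0} \<subseteq> {a. x a \<noteq> 0}"
      by (auto simp: y_def rat_linear_zero[OF rat_linear_ins])
    have "y \<in> carr"
      using x(1) sub finite_subset[OF sub] subset_trans[OF sub] unfolding carr_def
      by (simp add: y_def)
    moreover have "del {g} (ev p y) = ev p x"
    proof -
      have "del {g} (ev r y) = ev r x" if "set r \<subseteq> set p" for r
        using that
      proof (induction r)
        case Nil
        then show ?case by (simp add: rat_linear_zero[OF lin])
      next
        case (Cons z r)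
        obtain q a u where z: "z = (q, a, u)" by (cases z)
        have "z \<in> set p" using Cons.prems by simp
        then have "u \<in> Fpow B" "g \<notin> u" "g \<notin> supp (Re (x a))"
          using p g(2) z by (auto simp: in_lists_conv_set S_def)
        with Cons g(1) show ?case
          by (simp add: z y_def rat_linear_add[OF lin] rat_linear_scale[OF lin] del_ins)
      qed
      then show ?thesis by simp
    qed
    ultimately show ?thesis using x(2) by (intro bexI[of _ y]) (simp_all add: kev p_def)
  qed
  ultimately show ?thesis using k(1) by blast
qed

section \<open>Weight from below, and the chain of closed subgroups\<close>

text \<open>A basic neighbourhood involves finitely many functionals, and each list mentions
  finitely many coordinates.\<close>

lemma openin_contains_cofinite_coordinates:
  assumes "openin bohr_topology U" "0 \<in> U"
  shows "\<exists>K. finite K \<and> (\<forall>y\<in>carr. (\<forall>a\<in>K. y a = 0) \<longrightarrow> y \<in> U)"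
proof -
  obtain J \<delta> where J: "finite J" "J \<subseteq> A" "\<delta> > 0"
    "\<forall>y\<in>carr. (\<forall>j\<in>J. norm (cis (ev (e j) y) - cis (ev (e j) 0)) < \<delta>) \<longrightarrow> y \<in> U"
    using openin_bohr_nhd[OF assms] by blast
  let ?K = "\<Union>j\<in>J. (\<lambda>(q, a, u). a) ` set (e j)"
  have ev0: "ev p y = ev p 0" if "\<forall>a\<in>(\<lambda>(q, a, u). a) ` set p. y a = 0" for p y
    using that by (induction p) auto
  have "y \<in> U" if "y \<in> carr" "\<forall>a\<in>?K. y a = 0" for y
  proof -
    have "ev (e j) y = ev (e j) 0" if "j \<in> J" for j
      using that \<open>\<forall>a\<in>?K. y a = 0\<close> by (intro ev0) blast
    then show ?thesis using J(3,4) that(1) by auto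
  qed
  then show ?thesis using J(1) by (intro exI[of _ ?K]) auto
qed

text \<open>Each basic neighbourhood of 0 gets a finite set of coordinates from
  \<open>openin_contains_cofinite_coordinates\<close>. A neighbourhood that misses the unit vector
  at \<open>a\<close> must have \<open>a\<close> in its set, so these finite sets cover the infinite
  set \<open>A\<close>, which takes at least |A| of them.\<close>

lemma card_base_ge:
  assumes "topology_base bohr_topology \<B>"
  shows "|A| \<le>o |\<B>|"
proof -
  define \<B>0 where "\<B>0 = {U \<in> \<B>. 0 \<in> U}"
  have "\<forall>U\<in>\<B>0. \<exists>K. finite K \<and> (\<forall>y\<in>carr. (\<forall>a\<in>K. y a = 0) \<longrightarrow> y \<in> U)"
    using assms openin_contains_cofinite_coordinates
    by (auto simp: \<B>0_def topology_base_def)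
  then obtain K where K: "\<And>U. U \<in> \<B>0 \<Longrightarrow> finite (K U)"
      "\<And>U y. U \<in> \<B>0 \<Longrightarrow> y \<in> carr \<Longrightarrow> \<forall>a\<in>K U. y a = 0 \<Longrightarrow> y \<in> U"
    by metis
  have sub: "A \<subseteq> (\<Union>U\<in>\<B>0. K U)"
  proof
    fix a assume a: "a \<in> A"
    define y :: "'a \<Rightarrow> complex" where "y = (\<lambda>_. 0)(a := of_real 1)"
    have y: "y \<in> carr" "y \<noteq> 0"
      using single_mem[OF a, of 1] by (auto simp: y_def fun_eq_iff)
    then obtain i where i: "i \<in> A" "cis (ev (e i) y) \<noteq> 1" using separating by blast
    have "openin bohr_topology {z \<in> carr. cis (ev (e i) z) \<in> - {cis (ev (e i) y)}}"
      using i(1) by (rule openin_character_preimage) auto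
    moreover have "0 \<in> {z \<in> carr. cis (ev (e i) z) \<in> - {cis (ev (e i) y)}}"
      using i zero_mem l_zero[OF i(1)] by auto
    ultimately obtain U where U: "U \<in> \<B>" "0 \<in> U" "U \<subseteq> {z \<in> carr. cis (ev (e i) z) \<in> - {cis (ev (e i) y)}}"
      using assms unfolding topology_base_def by meson
    then have "y \<notin> U" "U \<in> \<B>0" by (auto simp: \<B>0_def)
    then obtain b where "b \<in> K U" "y b \<noteq> 0" using K(2)[of U y] y(1) by blast
    then show "a \<in> (\<Union>U\<in>\<B>0. K U)"
      using \<open>U \<in> \<B>0\<close> by (auto simp: y_def split: if_splits)
  qed
  have "infinite \<B>0"
  proof
    assume "finite \<B>0"
    then have "finite (\<Union>U\<in>\<B>0. K U)" using K(1) by blast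
    with sub infinite_A show False using finite_subset by blast
  qed
  then have "|\<Union>U\<in>\<B>0. K U| \<le>o |\<B>0|"
    by (rule card_of_UNION_ordLeq_infinite)
      (use \<open>infinite \<B>0\<close> K(1) in \<open>simp_all add: ordLess_imp_ordLeq finite_ordLess_infinite2\<close>)
  moreover have "|A| \<le>o |\<Union>U\<in>\<B>0. K U|" using sub by (rule card_of_mono1)
  moreover have "|\<B>0| \<le>o |\<B>|" by (rule card_of_mono1) (auto simp: \<B>0_def)
  ultimately show ?thesis by (metis ordLeq_transitive)
qed

lemma weight_bohr_topology:
  fixes \<tau> :: "'a rel"
  assumes "|A| =o \<tau>"
  shows "has_weight bohr_topology \<tau>"
proof -
  obtain \<B> where \<B>: "topology_base bohr_topology \<B>" "|\<B>| \<le>o |A|"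
    using exists_base_card_le[OF infinite_A] by blast
  have "|\<B>| =o |A|" using \<B>(2) card_base_ge[OF \<B>(1)] by (simp add: ordIso_iff_ordLeq)
  then have "|\<B>| =o \<tau>" using assms ordIso_transitive by blast
  moreover have "\<tau> \<le>o |\<B>'|" if "topology_base bohr_topology \<B>'" for \<B>'
    using card_base_ge[OF that] assms ordIso_symmetric ordIso_ordLeq_trans by blast
  ultimately show ?thesis using \<B>(1) by (auto simp: has_weight_def)
qed

lemma precompact_bohr: "precompact_group G bohr_topology"
  using topological_group_bohr topological_group_torus compact_space_torus emb_hom embedding_map_emb
  by (rule precompact_groupI)

text \<open>A real r with cis (q * r) = 1 for all rational q is 0, so the set is an intersection of
  kernels of characters.\<close>

lemma closed_coordinate_kernel:
  assumes "a \<in> A"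
  shows "closedin bohr_topology {x \<in> carr. x a = 0}"
proof -
  let ?I = "{i \<in> A. \<exists>q. e i = [(q, a, {})]}"
  have surj: "\<exists>i\<in>A. e i = [(q, a, {})]" for q
    using e_surj[of "[(q, a, {})]"] assms by (auto simp: Fpow_def)
  have "{x \<in> carr. x a = 0} = (\<Inter>i\<in>?I. {x \<in> carr. cis (ev (e i) x) = 1})" (is "?L = ?R")
  proof (intro subset_antisym subsetI)
    fix x assume "x \<in> ?L"
    then show "x \<in> ?R" by (auto simp: rat_linear_zero[OF rat_linear_del])
  next
    fix x assume x: "x \<in> ?R"
    \<comment> \<open>The value q = 0 only serves to show that the index set is nonempty.\<close>
    then have xc: "x \<in> carr" using surj[of 0] by auto
    moreover have "Re (x a) = 0"
    proof (rule ccontr)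
      assume "Re (x a) \<noteq> 0"
      then obtain q where q: "cis (of_rat q * Re (x a)) \<noteq> 1" using exists_rat_cis_neq_1 by blast
      obtain i where "i \<in> A" "e i = [(q, a, {})]" using surj by blast
      moreover from this have "cis (ev (e i) x) = 1" using x by blast
      ultimately show False using q by (simp add: del_empty)
    qed
    ultimately show "x \<in> ?L" by (auto simp: carr_def complex_eq_iff)
  qed
  moreover have "closedin bohr_topology ?R"
    using surj[of 0] by (intro closedin_Inter) (auto intro: closedin_kernel)
  ultimately show ?thesis by simp
qed

lemma exists_closed_chain:
  "\<exists>S :: nat \<Rightarrow> ('a \<Rightarrow> complex) set.
     (\<forall>n. subgroup (S n) G \<and> closedin bohr_topology (S n) \<and> S n \<noteq> carrier G) \<and>
     (\<forall>n. S n \<subset> S (Suc n)) \<and> carrier G = (\<Union>n. S n)"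
proof -
  obtain c :: "nat \<Rightarrow> 'a" where c: "inj c" "range c \<subseteq> A"
    using infinite_A infinite_countable_subset by blast
  define S where "S n = {x \<in> carr. \<forall>m\<ge>n. x (c m) = 0}" for n
  \<comment> \<open>This unit vector shows both that \<open>S n\<close> is proper and that the next
    inclusion is strict.\<close>
  have unit: "(\<lambda>_. 0)(c n := of_real 1) \<in> S (Suc n) - S n" for n
    using single_mem[of "c n" 1] c by (auto simp: S_def inj_eq)
  have sub: "subgroup (S n) G" for n
  proof (rule group.subgroupI[OF group_G])
    show "inv\<^bsub>G\<^esub> x \<in> S n" if "x \<in> S n" for x
      using that by (simp add: S_def inv_G minus_mem)
    show "x \<otimes>\<^bsub>G\<^esub> y \<in> S n" if "x \<in> S n" "y \<in> S n" for x y
      using that by (simp add: S_def add_mem additive_group_def)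
    show "S n \<noteq> {}" using zero_mem by (auto simp: S_def intro!: exI[of _ 0])
  qed (auto simp: S_def)
  have "closedin bohr_topology (S n)" for n
  proof -
    have "S n = (\<Inter>m\<in>{n..}. {x \<in> carr. x (c m) = 0})" by (auto simp: S_def)
    then show ?thesis using c by (auto intro!: closedin_Inter closed_coordinate_kernel)
  qed
  moreover have "S n \<subseteq> carrier G" for n
    by (auto simp: S_def)
  then have "S n \<noteq> carrier G" for n
    using unit[of n] by blast
  moreover have "S n \<subseteq> S (Suc n)" for n
    by (auto simp: S_def)
  then have "S n \<subset> S (Suc n)" for n
    using unit[of n] by blast
  moreover have "carrier G = (\<Union>n. S n)"
  proof (intro subset_antisym subsetI)
    fix x assume "x \<in> carrier G"
    then have x: "x \<in> carr" by simp
    then have "finite (c -` {a. x a \<noteq> 0})"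
      using c(1) by (intro finite_vimageI) (auto simp: carr_def)
    then obtain n where "\<forall>m\<in>c -` {a. x a \<noteq> 0}. m < n"
      using finite_nat_set_iff_bounded by blast
    then have "x \<in> S n" using x by (fastforce simp: S_def)
    then show "x \<in> (\<Union>n. S n)" by blast
  qed (auto simp: S_def)
  ultimately show ?thesis using sub by (intro exI[of _ S]) blast
qed

lemma quotients_trivial_or_non_separable:
  assumes "N \<lhd> G" "closedin bohr_topology N"
  shows "trivial_group (G Mod N) \<or> \<not> separable_space (coset_topology G bohr_topology N)"
  using exists_killing_functional assms by (rule non_separable_quotients)

end

section \<open>Cardinalities and conclusion\<close>

text \<open>Finite sets of reals number at most the continuum, hence at most |A|; so there are |A|
  triples and |A| lists of them. This allows \<open>A\<close> to index both the summands and the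
  functionals.\<close>

lemma exists_enumeration:
  assumes A: "infinite A" and R: "|UNIV :: real set| \<le>o |A|"
  shows "\<exists>e. e ` A = lists ((UNIV :: rat set) \<times> A \<times> Fpow (B :: real set))"
proof -
  let ?T = "(UNIV :: rat set) \<times> A \<times> Fpow B"
  have "|Fpow B| \<le>o |Fpow (UNIV :: real set)|"
    by (rule card_of_mono1) (auto simp: Fpow_def)
  also have "|Fpow (UNIV :: real set)| =o |UNIV :: real set|"
    by (rule card_of_Fpow_infinite) (rule infinite_UNIV_char_0)
  finally have "|Fpow B| \<le>o |A|" using R ordLeq_transitive by blast
  moreover have "Fpow B \<noteq> {}" by (auto simp: Fpow_def)
  ultimately have AF: "|A \<times> Fpow B| =o |A|" using A by (simp add: card_of_Times_infinite)
  have "|UNIV :: rat set| \<le>o |A|"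
    using A unfolding infinite_iff_card_of_nat
    by (meson card_of_ordLeq ordLeq_transitive inj_to_nat subset_UNIV)
  then have "|UNIV :: rat set| \<le>o |A \<times> Fpow B|"
    using AF ordIso_symmetric ordLeq_ordIso_trans by blast
  moreover have inf: "infinite (A \<times> Fpow B)"
    using A by (auto simp: finite_cartesian_product_iff Fpow_def)
  ultimately have T: "|?T| =o |A \<times> Fpow B|"
    by (simp add: card_of_Times_infinite)
  then have "|?T| =o |A|" using AF ordIso_transitive by blast
  moreover from this have "infinite ?T" using A card_of_ordIso_finite by blast
  then have "|lists ?T| =o |?T|" by (rule card_of_lists_infinite)
  ultimately have "|lists ?T| =o |A|" using ordIso_transitive by blast
  then have "|A| =o |lists ?T|" by (rule ordIso_symmetric)
  then obtain e where "bij_betw e A (lists ?T)" unfolding card_of_ordIso[symmetric] by blast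
  then show ?thesis by (auto simp: bij_betw_def)
qed

text \<open>Dedekind cuts inject the reals into the sets of rationals.\<close>

lemma card_real_ordLeq: "|UNIV :: real set| \<le>o ctwo ^c natLeq"
proof -
  have "inj (\<lambda>x::real. {q::rat. of_rat q < x})"
  proof (rule injI)
    fix x y :: real assume eq: "{q::rat. of_rat q < x} = {q. of_rat q < y}"
    have "\<not> a < b" if "{q::rat. of_rat q < a} = {q. of_rat q < b}" for a b :: real
    proof
      assume "a < b"
      then obtain q where "a < of_rat q" "of_rat q < b" using of_rat_dense by blast
      have "q \<in> {q. of_rat q < a}" unfolding that using \<open>of_rat q < b\<close> by simp
      with \<open>a < of_rat q\<close> show False by simp
    qed
    from this[OF eq] this[OF eq[symmetric]] show "x = y" by simp
  qed
  then have "|UNIV :: real set| \<le>o |Pow (UNIV :: rat set)|"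
    by (intro card_of_ordLeqI) auto
  also have "|Pow (UNIV :: rat set)| =o ctwo ^c |UNIV :: rat set|"
    by (rule Pow_cexp_ctwo)
  also have "ctwo ^c |UNIV :: rat set| \<le>o ctwo ^c natLeq"
  proof (rule cexp_mono2)
    have "|UNIV :: rat set| \<le>o |UNIV :: nat set|" by (meson card_of_ordLeq inj_to_nat subset_UNIV)
    then show "|UNIV :: rat set| \<le>o natLeq" using card_of_nat ordLeq_ordIso_trans by blast
  qed (auto simp: natLeq_Card_order card_of_Card_order ctwo_Cnotzero Card_order_ctwo dest: czeroE)
  finally show ?thesis .
qed

theorem theorem4p14:
  fixes \<tau> :: "'a rel"
  assumes "Card_order \<tau>" and "ctwo ^c natLeq \<le>o \<tau>"
  shows "\<exists>(H :: ('a \<Rightarrow> complex) monoid) X.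
           comm_group H \<and> precompact_group H X \<and>
           has_weight X \<tau> \<and>
           (\<exists>S :: nat \<Rightarrow> ('a \<Rightarrow> complex) set.
              (\<forall>n. subgroup (S n) H \<and> closedin X (S n) \<and> S n \<noteq> carrier H) \<and>
              (\<forall>n. S n \<subset> S (Suc n)) \<and>
              carrier H = (\<Union>n. S n)) \<and>
           (\<forall>N. N \<lhd> H \<and> closedin X N \<longrightarrow>
              trivial_group (H Mod N) \<or> \<not> separable_space (coset_topology H X N))"
proof -
  \<comment> \<open>The field of a cardinal order has that cardinality, and its elements have the
    type needed to index the summands.\<close>
  define A where "A = Field \<tau>"
  have A: "|A| =o \<tau>" unfolding A_def using assms(1) by (rule card_of_Field_ordIso)
  have "|UNIV :: real set| \<le>o \<tau>" using card_real_ordLeq assms(2) by (rule ordLeq_transitive)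
  then have R: "|UNIV :: real set| \<le>o |A|"
    using A ordIso_symmetric ordLeq_ordIso_trans by blast
  then have inf: "infinite A"
    using card_of_ordLeq_infinite infinite_UNIV_char_0 by blast
  obtain B del ins supp where "hamel_operators B del ins supp"
    using exists_hamel_operators by blast
  moreover obtain e where "e ` A = lists ((UNIV :: rat set) \<times> A \<times> Fpow B)"
    using exists_enumeration[OF inf R] by blast
  ultimately interpret direct_sum_functionals B del ins supp A e
    using inf by (simp add: direct_sum_functionals_def direct_sum_functionals_axioms_def)
  show ?thesis
    using comm_group_G precompact_bohr weight_bohr_topology[OF A] exists_closed_chain
      quotients_trivial_or_non_separable
    by blast
qed

end
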